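(* Let $(A_0,A_1)$ be a compatible couple of quasi-normed spaces, let $0<p\le\infty$ and $b_0,b_1\in SV_{0,p}$. For $t>0$ and $f\in A_0+A_1$ put $$\rho(t)=\frac{\|u^{-1/p}b_0(u)\|_{p,(t,\infty)}}{\|u^{-1/p}b_1(u)\|_{p,(t,\infty)}},$$ $$I(t,f)=\|u^{-1/p}b_0(u)K(u,f;A_0,A_1)\|_{p,(0,t)},\qquad J(t,f)=\|u^{-1/p}b_1(u)K(u,f;A_0,A_1)\|_{p,(t,\infty)}.$$ Assume that $\rho$ is increasing. In the case $p<\infty$, assume additionally that the couple $(A_0,A_1)$ is $K$-surjective. Then, for all $f\in A_0+A_1$ and all $t>0$, $$K(\rho(t),f;\bar A_{0,p;b_0},\bar A_{0,p;b_1})\approx I(t,f)+\rho(t)\,J(t,f).$$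
   Context: Notation: $\|\cdot\|_{q,(a,b)}$ is the $L^q$-quasi-norm on $(a,b)$ with respect to Lebesgue measure ($1/q=0$ if $q=\infty$). $A\lesssim B$ means $A\le cB$ with a positive constant $c$ independent of the appropriate parameters (here independent of $f$ and $t$); $A\approx B$ means $A\lesssim B$ and $B\lesssim A$. Slowly varying functions: a Lebesgue measurable $b:(0,\infty)\to(0,\infty)$ is slowly varying, $b\in SV$, if for every $\varepsilon>0$ there are positive functions $g_\varepsilon$ (non-decreasing) and $g_{-\varepsilon}$ (non-increasing) on $(0,\infty)$ with $t^{\varepsilon}b(t)\approx g_\varepsilon(t)$ and $t^{-\varepsilon}b(t)\approx g_{-\varepsilon}(t)$ for all $t>0$. For $0<q\le\infty$, $b\in SV_{0,q}$ means $b\in SV$ and $\|u^{-1/q}b(u)\|_{q,(1,\infty)}<\infty$. Compatible couple: quasi-normed spaces $A_0,A_1$ continuously embedded in the same Hausdorff topological vector space. For $f\in A_0+A_1$, $t>0$, $K(t,f;A_0,A_1)=\inf\{\|f_0\|_{A_0}+t\|f_1\|_{A_1}: f_0\in A_0,\ f_1\in A_1,\ f=f_0+f_1\}$, with the convention $\inf\emptyset=\infty$ when a $K$-functional is taken at an element outside the sum of the couple. For $0<q\le\infty$, $0\le\theta\le1$, $b\in SV$, $\bar A_{\theta,q;b}=(A_0,A_1)_{\theta,q;b}$ is the space of $f\in A_0+A_1$ with $\|f\|_{\bar A_{\theta,q;b}}=\|t^{-\theta-1/q}b(t)K(t,f;A_0,A_1)\|_{q,(0,\infty)}<\infty$. A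 function $\phi:(0,\infty)\to(0,\infty)$ is quasi-concave if both $\phi(t)$ and $t\phi(1/t)$ are non-decreasing. The couple $(A_0,A_1)$ is $K$-surjective if for every quasi-concave $\phi$ there is $f\in A_0+A_1$ with $\phi(t)\approx K(t,f;A_0,A_1)$, $t>0$. *)

theory Defs
  imports "HOL-Analysis.Analysis" "HOL-Probability.Essential_Supremum"
begin

section \<open>Quasi-norms of $L^q$ on subsets of the real line\<close>

definition epowr :: "ennreal \<Rightarrow> real \<Rightarrow> ennreal" where
  "epowr x r = (if x = \<infinity> then \<infinity> else ennreal (enn2real x powr r))"
  \<comment> \<open>used for exponents \<open>r > 0\<close> only\<close>

definition recip :: "ennreal \<Rightarrow> real" where
  "recip q = (if q = \<infinity> then 0 else 1 / enn2real q)"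

definition Lq_norm :: "ennreal \<Rightarrow> real set \<Rightarrow> (real \<Rightarrow> ennreal) \<Rightarrow> ennreal" where
  "Lq_norm q S g =
     (if q = \<infinity> then esssup (lebesgue_on S) g
      else epowr (\<integral>\<^sup>+ u. epowr (g u) (enn2real q) \<partial>lebesgue_on S) (1 / enn2real q))"


section \<open>Estimates up to constants\<close>

text \<open>The constant is uniform over all of \<open>S\<close>, which may consist of tuples of parameters.\<close>

definition lesssim_on :: "'x set \<Rightarrow> ('x \<Rightarrow> ennreal) \<Rightarrow> ('x \<Rightarrow> ennreal) \<Rightarrow> bool" where
  "lesssim_on S A B \<longleftrightarrow> (\<exists>c::real. c > 0 \<and> (\<forall>x\<in>S. A x \<le> ennreal c * B x))"

definition approx_on :: "'x set \<Rightarrow> ('x \<Rightarrow> ennreal) \<Rightarrow> ('x \<Rightarrow> ennreal) \<Rightarrow> bool" where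
  "approx_on S A B \<longleftrightarrow> lesssim_on S A B \<and> lesssim_on S B A"


section \<open>Slowly varying functions\<close>

text \<open>Functions on $(0,\infty)$ are total functions on the reals, whose values outside
  $(0,\infty)$ are irrelevant.\<close>

definition slowly_varying :: "(real \<Rightarrow> real) \<Rightarrow> bool" where
  "slowly_varying b \<longleftrightarrow>
     b \<in> borel_measurable (lebesgue_on {0<..}) \<and> (\<forall>t>0. b t > 0) \<and>
     (\<forall>\<epsilon>>0. \<exists>g h.
        (\<forall>t>0. g t > 0) \<and> mono_on {0<..} g \<and>
        (\<forall>t>0. h t > 0) \<and> antimono_on {0<..} h \<and>
        approx_on {0<..} (\<lambda>t. ennreal (t powr \<epsilon> * b t)) (\<lambda>t. ennreal (g t)) \<and>
        approx_on {0<..} (\<lambda>t. ennreal (t powr (-\<epsilon>) * b t)) (\<lambda>t. ennreal (h t)))"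

definition SV0 :: "ennreal \<Rightarrow> (real \<Rightarrow> real) set" where
  "SV0 q = {b. slowly_varying b \<and>
               Lq_norm q {1<..} (\<lambda>u. ennreal (u powr (- recip q) * b u)) < \<infinity>}"


section \<open>Quasi-normed spaces and compatible couples\<close>

text \<open>The spaces are subspaces of an ambient real vector space, given by the type \<open>'a\<close>.
  Complex spaces are covered by restriction of scalars.\<close>

record 'a qspace =
  space_of :: "'a set"
  qnorm :: "'a \<Rightarrow> real"

definition quasi_normed :: "'a::real_vector qspace \<Rightarrow> bool" where
  "quasi_normed A \<longleftrightarrow>
     subspace (space_of A) \<and>
     (\<forall>x\<in>space_of A. qnorm A x \<ge> 0 \<and> (qnorm A x = 0 \<longleftrightarrow> x = 0)) \<and>
     (\<forall>c. \<forall>x\<in>space_of A. qnorm A (c *\<^sub>R x) = \<bar>c\<bar> * qnorm A x) \<and>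
     (\<exists>C\<ge>1. \<forall>x\<in>space_of A. \<forall>y\<in>space_of A. qnorm A (x + y) \<le> C * (qnorm A x + qnorm A y))"

text \<open>Quasi-norm balls need not be open, but they form neighbourhood bases.\<close>

definition qnorm_topology :: "'a::real_vector qspace \<Rightarrow> 'a topology" where
  "qnorm_topology A = topology (\<lambda>U. U \<subseteq> space_of A \<and>
     (\<forall>x\<in>U. \<exists>r>0. \<forall>y\<in>space_of A. qnorm A (y - x) < r \<longrightarrow> y \<in> U))"

lemma openin_qnorm_topology:
  "openin (qnorm_topology A) U \<longleftrightarrow> U \<subseteq> space_of A \<and>
     (\<forall>x\<in>U. \<exists>r>0. \<forall>y\<in>space_of A. qnorm A (y - x) < r \<longrightarrow> y \<in> U)"
proof -
  let ?P = "\<lambda>U. U \<subseteq> space_of A \<and>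
     (\<forall>x\<in>U. \<exists>r>0. \<forall>y\<in>space_of A. qnorm A (y - x) < r \<longrightarrow> y \<in> U)"
  have "istopology ?P"
    unfolding istopology_def
  proof (intro conjI allI impI)
    fix S T assume S: "?P S" and T: "?P T"
    show "S \<inter> T \<subseteq> space_of A" using S by blast
    show "\<forall>x\<in>S \<inter> T. \<exists>r>0. \<forall>y\<in>space_of A. qnorm A (y - x) < r \<longrightarrow> y \<in> S \<inter> T"
    proof
      fix x assume x: "x \<in> S \<inter> T"
      obtain r where "r > 0" "\<forall>y\<in>space_of A. qnorm A (y - x) < r \<longrightarrow> y \<in> S"
        using S x by blast
      moreover obtain s where "s > 0" "\<forall>y\<in>space_of A. qnorm A (y - x) < s \<longrightarrow> y \<in> T"
        using T x by blast
      ultimately show "\<exists>r>0. \<forall>y\<in>space_of A. qnorm A (y - x) < r \<longrightarrow> y \<in> S \<inter> T"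
        by (intro exI[of _ "min r s"]) auto
    qed
  next
    fix K assume K: "\<forall>S\<in>K. ?P S"
    show "\<Union>K \<subseteq> space_of A" using K by blast
    show "\<forall>x\<in>\<Union>K. \<exists>r>0. \<forall>y\<in>space_of A. qnorm A (y - x) < r \<longrightarrow> y \<in> \<Union>K"
    proof
      fix x assume "x \<in> \<Union>K"
      then obtain S where "S \<in> K" "x \<in> S" by blast
      then obtain r where "r > 0" "\<forall>y\<in>space_of A. qnorm A (y - x) < r \<longrightarrow> y \<in> S"
        using K by blast
      then show "\<exists>r>0. \<forall>y\<in>space_of A. qnorm A (y - x) < r \<longrightarrow> y \<in> \<Union>K"
        using \<open>S \<in> K\<close> by blast
    qed
  qed
  then show ?thesis
    unfolding qnorm_topology_def by (simp add: topology_inverse')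
qed

definition hausdorff_tvs :: "'a::real_vector topology \<Rightarrow> bool" where
  "hausdorff_tvs T \<longleftrightarrow>
     topspace T = UNIV \<and> Hausdorff_space T \<and>
     continuous_map (prod_topology T T) T (\<lambda>(x, y). x + y) \<and>
     continuous_map (prod_topology euclideanreal T) T (\<lambda>(c, x). c *\<^sub>R x)"

definition compatible_couple :: "'a::real_vector qspace \<Rightarrow> 'a qspace \<Rightarrow> bool" where
  "compatible_couple A0 A1 \<longleftrightarrow>
     quasi_normed A0 \<and> quasi_normed A1 \<and>
     (\<exists>T. hausdorff_tvs T \<and>
          continuous_map (qnorm_topology A0) T (\<lambda>x. x) \<and>
          continuous_map (qnorm_topology A1) T (\<lambda>x. x))"

definition sum_space :: "'a::real_vector qspace \<Rightarrow> 'a qspace \<Rightarrow> 'a set" where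
  "sum_space A0 A1 = {f0 + f1 | f0 f1. f0 \<in> space_of A0 \<and> f1 \<in> space_of A1}"


section \<open>The K-functional and interpolation spaces\<close>

text \<open>The infimum is taken in the extended nonnegative reals, so it is \<open>\<infinity>\<close> if \<open>f\<close> does not
  lie in the sum of the couple.\<close>

definition K_fun :: "real \<Rightarrow> 'a \<Rightarrow> 'a::real_vector qspace \<Rightarrow> 'a qspace \<Rightarrow> ennreal" where
  "K_fun t f A0 A1 =
     Inf {ennreal (qnorm A0 f0 + t * qnorm A1 f1) | f0 f1.
            f0 \<in> space_of A0 \<and> f1 \<in> space_of A1 \<and> f = f0 + f1}"

definition interp_norm ::
    "real \<Rightarrow> ennreal \<Rightarrow> (real \<Rightarrow> real) \<Rightarrow> 'a::real_vector qspace \<Rightarrow> 'a qspace \<Rightarrow> 'a \<Rightarrow> ennreal" where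
  "interp_norm \<theta> q b A0 A1 f =
     Lq_norm q {0<..} (\<lambda>t. ennreal (t powr (- \<theta> - recip q) * b t) * K_fun t f A0 A1)"

definition interp_space ::
    "real \<Rightarrow> ennreal \<Rightarrow> (real \<Rightarrow> real) \<Rightarrow> 'a::real_vector qspace \<Rightarrow> 'a qspace \<Rightarrow> 'a qspace" where
  "interp_space \<theta> q b A0 A1 =
     \<lparr>space_of = {f \<in> sum_space A0 A1. interp_norm \<theta> q b A0 A1 f < \<infinity>},
      qnorm = (\<lambda>f. enn2real (interp_norm \<theta> q b A0 A1 f))\<rparr>"

definition quasi_concave :: "(real \<Rightarrow> real) \<Rightarrow> bool" where
  "quasi_concave \<phi> \<longleftrightarrow>
     (\<forall>t>0. \<phi> t > 0) \<and> mono_on {0<..} \<phi> \<and> mono_on {0<..} (\<lambda>t. t * \<phi> (1 / t))"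

definition K_surjective :: "'a::real_vector qspace \<Rightarrow> 'a qspace \<Rightarrow> bool" where
  "K_surjective A0 A1 \<longleftrightarrow>
     (\<forall>\<phi>. quasi_concave \<phi> \<longrightarrow>
        (\<exists>f\<in>sum_space A0 A1. approx_on {0<..} (\<lambda>t. ennreal (\<phi> t)) (\<lambda>t. K_fun t f A0 A1)))"

end

theory Submission
  imports Defs
begin

text \<open>
  Write $w_i(u) = u^{-1/p} b_i(u)$ and $B_i(t) = \|w_i\|_{p,(t,\infty)}$, so that $\rho = B_0 / B_1$;
  both $B_i(t)$ are positive and finite. Of the $K$-functional the proof uses that it
  is non-decreasing in $u$, that it satisfies a quasi-triangle inequality, and that $K(u, g)$ is at
  most $\|g\|_{A_0}$ for $g \in A_0$ and at most $u \|g\|_{A_1}$ for $g \in A_1$.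

  For the upper estimate, take an almost optimal decomposition $f = f_0 + f_1$ for $K(t, f)$ in
  $(A_0, A_1)$. Then $K(u, f_0) \lesssim K(u, f) + \frac{u}{t} K(t,f)$ for $u < t$ and
  $K(u, f_0) \lesssim K(t, f)$ for $u > t$, with similar bounds for $f_1$. Slow variation gives
  $\|\frac{u}{t} w_i\|_{p,(0,t)} \lesssim B_i(t)$ (lemma \<open>head_le_tail\<close>). Hence $f_0$ and $f_1$ have
  interpolation norms bounded by multiples of $I(t,f) + B_0(t) K(t,f)$ and $J(t,f) + B_1(t) K(t,f)$, and the last
  terms are absorbed because $B_0 = \rho B_1$ and $B_1(t) K(t,f) \le J(t,f)$.

  For the lower estimate, let $f = f_0 + f_1$ with $f_i$ in the $i$-th interpolation space. The
  quasi-triangle inequality reduces the claim to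
  \[ \|w_0 F\|_{p,(0,t)} \le \rho(t) \|w_1 F\|_{p,(0,\infty)}, \qquad
     \rho(t) \|w_1 F\|_{p,(t,\infty)} \le \|w_0 F\|_{p,(0,\infty)} \]
  for a non-decreasing $F$, here $F(u) = K(u, f_i)$. A non-decreasing function is a superposition of
  indicators of rays $(s,\infty)$, and for those indicators both inequalities follow from the
  monotonicity of $\rho$. Lemma \<open>Lq_norm_weighted_mono_le\<close> makes this reduction precise, through
  the layer cake formula when $p < \infty$ and through level sets at rational heights when
  $p = \infty$. The lemmas \<open>K_interp_upper\<close> and \<open>K_interp_lower\<close> contain the two halves.
\<close>

section \<open>Powers, infima and estimates in the extended nonnegative reals\<close>

lemma epowr_0 [simp]: "epowr 0 r = 0"
  and epowr_1 [simp]: "epowr 1 r = 1"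
  by (simp_all add: epowr_def)

lemma epowr_ennreal: "0 \<le> x \<Longrightarrow> epowr (ennreal x) r = ennreal (x powr r)"
  by (simp add: epowr_def)

lemma epowr_top [simp]: "epowr top r = top"
  by (simp add: epowr_def)

lemma epowr_mono:
  assumes "0 \<le> r" "x \<le> y" shows "epowr x r \<le> epowr y r"
  using assms
  by (cases x; cases y) (auto simp: epowr_ennreal top_unique intro!: ennreal_leI powr_mono2)

lemma epowr_mult: "epowr (x * y) r = epowr x r * epowr y r"
  by (cases x; cases y)
    (auto simp: epowr_ennreal ennreal_mult[symmetric] powr_mult ennreal_top_mult ennreal_mult_top
       epowr_def[of 0])

lemma epowr_epowr: "r \<noteq> 0 \<Longrightarrow> epowr (epowr x r) (1 / r) = x"
  by (cases x) (auto simp: epowr_ennreal powr_powr)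

lemma borel_measurable_epowr [measurable]:
  assumes [measurable]: "f \<in> borel_measurable M"
  shows "(\<lambda>x. epowr (f x) r) \<in> borel_measurable M"
proof -
  have "Measurable.pred M (\<lambda>x. f x = \<infinity>)"
    using borel_measurable_eq[of f M "\<lambda>_. \<infinity>"] by (simp add: pred_def)
  then show ?thesis unfolding epowr_def
    by (intro measurable_If) (auto simp: pred_def)
qed

text \<open>
  The sum is at most twice the larger term. This crude form is what is available for
  exponents below $1$ as well, and a constant is harmless throughout.
\<close>

lemma epowr_add_le:
  assumes "0 \<le> r"
  shows "epowr (x + y) r \<le> epowr 2 r * (epowr x r + epowr y r)"
proof -
  have "x + y \<le> 2 * max x y"
    unfolding mult_2 by (intro add_mono) auto
  then have "epowr (x + y) r \<le> epowr 2 r * epowr (max x y) r"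
    using assms by (metis epowr_mono epowr_mult)
  also have "epowr (max x y) r \<le> epowr x r + epowr y r"
    by (cases "x \<le> y") (auto simp: max_def)
  finally show ?thesis by (simp add: mult_left_mono)
qed

lemma lesssim_onI:
  assumes "\<And>x. x \<in> S \<Longrightarrow> A x \<le> ennreal c * B x"
  shows "lesssim_on S A B"
  unfolding lesssim_on_def
proof (intro exI[of _ "max c 1"] conjI ballI)
  fix x assume "x \<in> S"
  then have "A x \<le> ennreal c * B x" by (rule assms)
  also have "\<dots> \<le> ennreal (max c 1) * B x" by (intro mult_right_mono ennreal_leI) auto
  finally show "A x \<le> ennreal (max c 1) * B x" .
qed simp

text \<open>
  Passes a bound over two independent decompositions to the infima, without asking whether
  either index set is empty; this is how estimates for single decompositions become estimates
  for $K$-functionals.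
\<close>

lemma le_mult_add_Inf:
  fixes S T :: "ennreal set"
  assumes "0 < c" and le: "\<And>a b. a \<in> S \<Longrightarrow> b \<in> T \<Longrightarrow> z \<le> ennreal c * (a + b)"
  shows "z \<le> ennreal c * (Inf S + Inf T)"
proof (rule ennreal_le_epsilon)
  fix e :: real assume fin: "ennreal c * (Inf S + Inf T) < top" and e: "0 < e"
  define d where "d = e / (2 * c)"
  have d: "0 < d" "c * (d + d) = e" using e assms(1) by (simp_all add: d_def)
  have "Inf S + Inf T \<noteq> top"
  proof
    assume top: "Inf S + Inf T = top"
    show False using fin assms(1) unfolding top by (simp add: ennreal_mult_top)
  qed
  then obtain x y where xy: "Inf S = ennreal x" "0 \<le> x" "Inf T = ennreal y" "0 \<le> y"
    by (cases "Inf S"; cases "Inf T") auto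
  have "Inf S < ennreal (x + d)" "Inf T < ennreal (y + d)"
    using xy d by (auto simp: ennreal_less_iff)
  then obtain a b where ab: "a \<in> S" "b \<in> T" "a < ennreal (x + d)" "b < ennreal (y + d)"
    by (auto simp: Inf_less_iff)
  have "z \<le> ennreal c * (a + b)" by (rule le[OF ab(1,2)])
  also have "\<dots> \<le> ennreal c * (ennreal (x + d) + ennreal (y + d))"
    using ab by (intro mult_left_mono add_mono) auto
  also have "\<dots> = ennreal (c * (x + y) + c * (d + d))"
    using xy d assms(1) by (simp add: ennreal_mult[symmetric] ennreal_plus[symmetric] algebra_simps del: ennreal_plus)
  also have "\<dots> = ennreal c * (Inf S + Inf T) + ennreal e"
    using xy d(2) e assms(1) by (simp add: ennreal_mult)
  finally show "z \<le> ennreal c * (Inf S + Inf T) + ennreal e" .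
qed

lemma le_mult_Inf:
  fixes S :: "ennreal set"
  assumes "0 < c" and "\<And>a. a \<in> S \<Longrightarrow> z \<le> ennreal c * a"
  shows "z \<le> ennreal c * Inf S"
  using le_mult_add_Inf[of c S "{0}" z] assms by simp

section \<open>Quasi-norms of $L^p$ on the positive half-line\<close>

text \<open>
  All quasi-norms are transported to the whole half-line, with the interval of integration moved
  into an indicator function. Splitting an interval is then a pointwise inequality.
\<close>

abbreviation (input) half_line :: "real measure" where "half_line \<equiv> lebesgue_on {0<..}"

abbreviation (input) Npos :: "ennreal \<Rightarrow> (real \<Rightarrow> ennreal) \<Rightarrow> ennreal" where
  "Npos p g \<equiv> Lq_norm p {0<..} g"

lemma finite_exponent:
  assumes "0 < p" "p < \<infinity>" shows "0 < enn2real p"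
  using assms by (simp add: enn2real_positive_iff)

lemma Lq_norm_top: "Lq_norm \<infinity> S g = esssup (lebesgue_on S) g"
  by (simp add: Lq_norm_def)

lemma Lq_norm_finite:
  "p < \<infinity> \<Longrightarrow> Lq_norm p S g = 
     epowr (\<integral>\<^sup>+ u. epowr (g u) (enn2real p) \<partial>lebesgue_on S) (1 / enn2real p)"
  by (auto simp add: Lq_norm_def)

text \<open>
  Reduces an estimate of the quasi-norm to one of the integral, so that the outer root
  disappears.
\<close>

lemma Lq_norm_le_iff:
  assumes "0 < p" "p < \<infinity>"
  shows "Lq_norm p S g \<le> M \<longleftrightarrow>
    (\<integral>\<^sup>+ u. epowr (g u) (enn2real p) \<partial>lebesgue_on S) \<le> epowr M (enn2real p)"
proof -
  have r: "0 < enn2real p" using finite_exponent assms by blast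
  let ?I = "\<integral>\<^sup>+ u. epowr (g u) (enn2real p) \<partial>lebesgue_on S"
  have "epowr (epowr ?I (1 / enn2real p)) (enn2real p) = ?I"
    using epowr_epowr[of "1 / enn2real p"] r by simp
  then show ?thesis
    using epowr_mono[of "1 / enn2real p" ?I "epowr M (enn2real p)"] r epowr_epowr[of "enn2real p" M]
      epowr_mono[of "enn2real p" "Lq_norm p S g" M]
    unfolding Lq_norm_finite[OF assms(2)] by auto
qed

lemma Lq_norm_mono:
  assumes "0 < p" "g \<in> borel_measurable (lebesgue_on S)"
    "AE u in lebesgue_on S. g u \<le> h u"
  shows "Lq_norm p S g \<le> Lq_norm p S h"
proof (cases "p = \<infinity>")
  case True
  show ?thesis unfolding True Lq_norm_top using assms(2,3) by (rule esssup_AE_mono)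
next
  case False
  then have p: "p < \<infinity>" by (simp add: less_top)
  note r = finite_exponent[OF assms(1) p]
  show ?thesis unfolding Lq_norm_finite[OF p] using r assms
    by (intro epowr_mono nn_integral_mono_AE) (auto intro: epowr_mono elim!: eventually_mono)
qed

text \<open>
  The inequality alone holds for every extended constant; equality is proved below for positive
  real constants, where the constant can be inverted.
\<close>

lemma Lq_norm_cmult:
  assumes "0 < p" "g \<in> borel_measurable (lebesgue_on S)"
  shows "Lq_norm p S (\<lambda>u. c * g u) \<le> c * Lq_norm p S g"
proof (cases "p = \<infinity>")
  case True
  have "AE u in lebesgue_on S. c * g u \<le> c * esssup (lebesgue_on S) g"
    using esssup_AE[of g "lebesgue_on S"] by (auto elim!: eventually_mono intro: mult_left_mono)
  then show ?thesis unfolding True Lq_norm_top using assms(2) by (intro esssup_I) auto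
next
  case False
  then have p: "p < \<infinity>" by (simp add: less_top)
  note r = finite_exponent[OF assms(1) p]
  show ?thesis unfolding Lq_norm_finite[OF p] using r assms(2)
    by (simp add: epowr_mult nn_integral_cmult epowr_epowr)
qed

lemma Lq_norm_cmult_eq:
  assumes "0 < p" and [measurable]: "g \<in> borel_measurable (lebesgue_on S)" and "0 < c"
  shows "Lq_norm p S (\<lambda>u. ennreal c * g u) = ennreal c * Lq_norm p S g"
proof (rule antisym)
  have inv: "ennreal (1 / c) * ennreal c = 1" using assms(3) by (simp add: ennreal_mult[symmetric])
  have "Lq_norm p S g = Lq_norm p S (\<lambda>u. ennreal (1 / c) * (ennreal c * g u))"
    by (simp add: mult.assoc[symmetric] inv)
  also have "\<dots> \<le> ennreal (1 / c) * Lq_norm p S (\<lambda>u. ennreal c * g u)"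
    by (rule Lq_norm_cmult[OF assms(1)]) measurable
  finally have "ennreal c * Lq_norm p S g \<le> ennreal c * (ennreal (1 / c) * Lq_norm p S (\<lambda>u. ennreal c * g u))"
    by (rule mult_left_mono) simp
  also have "\<dots> = (ennreal (1 / c) * ennreal c) * Lq_norm p S (\<lambda>u. ennreal c * g u)"
    by (simp only: mult_ac)
  finally show "ennreal c * Lq_norm p S g \<le> Lq_norm p S (\<lambda>u. ennreal c * g u)"
    by (simp add: inv)
qed (rule Lq_norm_cmult[OF assms(1,2)])

lemma Lq_norm_quasi_triangle:
  assumes "0 < p"
  obtains C :: real where "C \<ge> 1"
    "\<And>S g h. g \<in> borel_measurable (lebesgue_on S) \<Longrightarrow> h \<in> borel_measurable (lebesgue_on S) \<Longrightarrow>
       Lq_norm p S (\<lambda>u. g u + h u) \<le> ennreal C * (Lq_norm p S g + Lq_norm p S h)"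
proof (cases "p = \<infinity>")
  case True
  have "Lq_norm p S (\<lambda>u. g u + h u) \<le> ennreal 1 * (Lq_norm p S g + Lq_norm p S h)"
    if [measurable]: "g \<in> borel_measurable (lebesgue_on S)" "h \<in> borel_measurable (lebesgue_on S)" for S g h
    unfolding True Lq_norm_top
  proof (intro esssup_I)
    show "AE u in lebesgue_on S. g u + h u \<le> ennreal 1 * (esssup (lebesgue_on S) g + esssup (lebesgue_on S) h)"
      using esssup_AE[of g "lebesgue_on S"] esssup_AE[of h "lebesgue_on S"]
      by eventually_elim (auto intro: add_mono)
  qed measurable
  then show ?thesis using that[of 1] by auto
next
  case False
  then have p: "p < \<infinity>" by (simp add: less_top)
  let ?r = "enn2real p"
  note r = finite_exponent[OF assms(1) p]
  define C where "C = 2 * 2 powr (1 / ?r)"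
  have C: "ennreal C = 2 * epowr 2 (1 / ?r)"
    unfolding C_def using epowr_ennreal[of 2 "1 / ?r"]
    by (simp add: ennreal_mult)
  have "1 * 1 \<le> C" unfolding C_def using r by (intro mult_mono) (auto intro: ge_one_powr_ge_zero)
  moreover have "Lq_norm p S (\<lambda>u. g u + h u) \<le> ennreal C * (Lq_norm p S g + Lq_norm p S h)"
    if [measurable]: "g \<in> borel_measurable (lebesgue_on S)" "h \<in> borel_measurable (lebesgue_on S)" for S g h
  proof -
    let ?M = "lebesgue_on S"
    have "(\<integral>\<^sup>+ u. epowr (g u + h u) ?r \<partial>?M) \<le> (\<integral>\<^sup>+ u. epowr 2 ?r * (epowr (g u) ?r + epowr (h u) ?r) \<partial>?M)"
      using r by (intro nn_integral_mono epowr_add_le) auto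
    also have "\<dots> = epowr 2 ?r * ((\<integral>\<^sup>+ u. epowr (g u) ?r \<partial>?M) + (\<integral>\<^sup>+ u. epowr (h u) ?r \<partial>?M))"
      by (simp add: nn_integral_cmult nn_integral_add)
    finally have "Lq_norm p S (\<lambda>u. g u + h u) \<le>
        epowr (epowr 2 ?r * ((\<integral>\<^sup>+ u. epowr (g u) ?r \<partial>?M) + (\<integral>\<^sup>+ u. epowr (h u) ?r \<partial>?M))) (1 / ?r)"
      unfolding Lq_norm_finite[OF p] using r by (intro epowr_mono) auto
    also have "\<dots> = 2 * epowr ((\<integral>\<^sup>+ u. epowr (g u) ?r \<partial>?M) + (\<integral>\<^sup>+ u. epowr (h u) ?r \<partial>?M)) (1 / ?r)"
      using r by (simp add: epowr_mult epowr_epowr)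
    also have "\<dots> \<le> 2 * (epowr 2 (1 / ?r) * (Lq_norm p S g + Lq_norm p S h))"
      unfolding Lq_norm_finite[OF p] using r by (intro mult_left_mono epowr_add_le) auto
    finally show ?thesis unfolding C by (simp add: mult.assoc)
  qed
  ultimately show ?thesis using that[of C] by auto
qed

text \<open>
  A function and its product with the indicator of a subset have the same integral there, and the
  value $0$ outside does not affect an essential supremum of nonnegative functions.
\<close>

lemma Lq_norm_subset:
  assumes "0 < p" "T \<in> sets lebesgue" "S \<in> sets lebesgue" "S \<subseteq> T"
    "g \<in> borel_measurable (lebesgue_on T)"
  shows "Lq_norm p S g = Lq_norm p T (\<lambda>u. g u * indicator S u)"
proof (cases "p = \<infinity>")
  case True
  have S: "S \<in> sets (lebesgue_on T)" using assms by (auto simp: sets_restrict_space)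
  have gS: "g \<in> borel_measurable (lebesgue_on S)"
    using measurable_restrict_mono[OF assms(5)] assms(4) by auto
  have gT: "(\<lambda>u. g u * indicator S u) \<in> borel_measurable (lebesgue_on T)"
    using assms(5) S by measurable
  have "(AE u in lebesgue_on S. g u \<le> z) = (AE u in lebesgue_on T. g u * indicator S u \<le> z)" for z
    using assms(2-4)
    by (subst (1 2) AE_restrict_space_iff)
       (auto intro!: AE_cong simp: indicator_def)
  then show ?thesis unfolding True Lq_norm_top
    using gS gT by (simp add: esssup_eq_AE)
next
  case False
  then have p: "p < \<infinity>" by (simp add: less_top)
  have "(\<integral>\<^sup>+ u. epowr (g u) (enn2real p) \<partial>lebesgue_on S) = 
        (\<integral>\<^sup>+ u. epowr (g u * indicator S u) (enn2real p) \<partial>lebesgue_on T)"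
    using assms(2-4)
    by (subst (1 2) nn_integral_restrict_space)
       (auto intro!: nn_integral_cong simp: indicator_def)
  then show ?thesis unfolding Lq_norm_finite[OF p] by simp
qed

lemma borel_measurable_half_line_ident [measurable]: "(\<lambda>u. u) \<in> borel_measurable half_line"
  by (rule measurable_restrict_space1) (rule measurable_completion, simp)

lemma AE_half_line_neq: "AE u in half_line. u \<noteq> (a::real)"
  using AE_lborel_singleton[of a]
  by (subst AE_restrict_space_iff) (auto intro!: AE_completion elim!: eventually_mono)

lemma mono_on_borel_measurable_half_line:
  fixes F :: "real \<Rightarrow> real"
  assumes "mono_on {0<..} F" shows "F \<in> borel_measurable half_line"
proof -
  have "sets (restrict_space borel {0<..}) \<subseteq> sets half_line"
    unfolding sets_restrict_space by (intro image_mono subsetI) (simp add: sets_completionI_sets)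
  then show ?thesis
    using borel_measurable_mono_on_fnc[OF assms]
    by (auto simp: measurable_def space_restrict_space)
qed

text \<open>
  A Fatou property at the origin: monotone convergence for finite $p$, a countable union of null
  sets for $p = \infty$. It serves to let a truncation point tend to $0$, where a weight need not
  be integrable.
\<close>

lemma Lq_norm_le_of_truncations:
  assumes "0 < p" and [measurable]: "g \<in> borel_measurable half_line"
    and "\<And>\<delta>. \<delta> > 0 \<Longrightarrow> Npos p (\<lambda>u. g u * indicator {\<delta><..} u) \<le> M"
  shows "Npos p g \<le> M"
proof (cases "p = \<infinity>")
  case True
  have "AE u in half_line. \<forall>n::nat. g u * indicator {1 / (real n + 1)<..} u \<le> M"
    unfolding AE_all_countable
  proof
    fix n :: nat
    show "AE u in half_line. g u * indicator {1 / (real n + 1)<..} u \<le> M"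
      using esssup_AE[of "\<lambda>u. g u * indicator {1 / (real n + 1)<..} u" half_line] assms(3)[of "1 / (real n + 1)"]
      unfolding True Lq_norm_top by (auto elim!: eventually_mono)
  qed
  then have "AE u in half_line. g u \<le> M"
  proof (rule AE_mp, intro AE_I2 impI)
    fix u assume u: "u \<in> space half_line" "\<forall>n::nat. g u * indicator {1 / (real n + 1)<..} u \<le> M"
    then have "u > 0" by (simp add: space_restrict_space)
    then obtain n :: nat where "1 / (real n + 1) < u"
      using reals_Archimedean[of u] by (auto simp: inverse_eq_divide add.commute)
    then show "g u \<le> M" using u(2)[rule_format, of n] by simp
  qed
  then show ?thesis unfolding True Lq_norm_top by (intro esssup_I) auto
next
  case False
  then have p: "p < \<infinity>" by (simp add: less_top)
  let ?r = "enn2real p"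
  let ?g = "\<lambda>n u. epowr (g u * indicator {1 / (real n + 1)<..} u) ?r"
  note r = finite_exponent[OF assms(1) p]
  have "(\<integral>\<^sup>+ u. epowr (g u) ?r \<partial>half_line) = (\<integral>\<^sup>+ u. (SUP n. ?g n u) \<partial>half_line)"
  proof (rule nn_integral_cong)
    fix u assume u: "u \<in> space half_line"
    then have "u > 0" by (simp add: space_restrict_space)
    then obtain n :: nat where "1 / (real n + 1) < u"
      using reals_Archimedean[of u] by (auto simp: inverse_eq_divide add.commute)
    then have "epowr (g u) ?r \<le> (SUP n. ?g n u)"
      by (intro SUP_upper2[of n]) auto
    moreover have "(SUP n. ?g n u) \<le> epowr (g u) ?r"
      using r by (intro SUP_least epowr_mono) (auto simp: indicator_def)
    ultimately show "epowr (g u) ?r = (SUP n. ?g n u)" by simp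
  qed
  also have "\<dots> = (SUP n. \<integral>\<^sup>+ u. ?g n u \<partial>half_line)"
  proof (rule nn_integral_monotone_convergence_SUP)
    show "incseq ?g"
    proof (intro incseq_SucI le_funI epowr_mono mult_left_mono)
      fix n u
      have "1 / (real (Suc n) + 1) \<le> 1 / (real n + 1)" by (simp add: field_simps)
      then show "indicator {1 / (real n + 1)<..} u \<le> (indicator {1 / (real (Suc n) + 1)<..} u :: ennreal)"
        by (auto simp: indicator_def)
    qed (use r in auto)
  qed measurable
  also have "\<dots> \<le> epowr M ?r"
  proof (rule SUP_least)
    fix n
    show "(\<integral>\<^sup>+ u. ?g n u \<partial>half_line) \<le> epowr M ?r"
      using assms(3)[of "1 / (real n + 1)"] Lq_norm_le_iff[OF assms(1) p] by auto
  qed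
  finally show ?thesis using Lq_norm_le_iff[OF assms(1) p] by blast
qed

text \<open>
  The cut point is a null set and may be ignored, so different pointwise bounds can be used on its
  two sides.
\<close>

lemma Lq_norm_split_at:
  assumes "0 < p"
  obtains C :: real where "C \<ge> 1"
    "\<And>t h h1 h2. h \<in> borel_measurable half_line \<Longrightarrow> h1 \<in> borel_measurable half_line \<Longrightarrow>
       h2 \<in> borel_measurable half_line \<Longrightarrow>
       \<forall>u. 0 < u \<and> u < t \<longrightarrow> h u \<le> h1 u \<Longrightarrow> \<forall>u. 0 < u \<and> t < u \<longrightarrow> h u \<le> h2 u \<Longrightarrow>
       Npos p h \<le> ennreal C * (Npos p (\<lambda>u. h1 u * indicator {..<t} u) + Npos p (\<lambda>u. h2 u * indicator {t<..} u))"
proof -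
  obtain C where C: "C \<ge> 1" "\<And>S g h. g \<in> borel_measurable (lebesgue_on S) \<Longrightarrow> h \<in> borel_measurable (lebesgue_on S) \<Longrightarrow>
       Lq_norm p S (\<lambda>u. g u + h u) \<le> ennreal C * (Lq_norm p S g + Lq_norm p S h)"
    using Lq_norm_quasi_triangle[OF assms(1)] by metis
  have "Npos p h \<le> ennreal C * (Npos p (\<lambda>u. h1 u * indicator {..<t} u) + Npos p (\<lambda>u. h2 u * indicator {t<..} u))"
    if [measurable]: "h \<in> borel_measurable half_line" "h1 \<in> borel_measurable half_line" "h2 \<in> borel_measurable half_line"
      and le: "\<forall>u. 0 < u \<and> u < t \<longrightarrow> h u \<le> h1 u" "\<forall>u. 0 < u \<and> t < u \<longrightarrow> h u \<le> h2 u" for t h h1 h2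
  proof -
    have "Npos p h \<le> Npos p (\<lambda>u. h1 u * indicator {..<t} u + h2 u * indicator {t<..} u)"
    proof (rule Lq_norm_mono[OF assms(1)])
      show "AE u in half_line. h u \<le> h1 u * indicator {..<t} u + h2 u * indicator {t<..} u"
        using AE_half_line_neq[of t] AE_space[of half_line]
      proof eventually_elim
        case (elim u)
        then show ?case using le by (cases "u < t") (auto simp: space_restrict_space)
      qed
    qed measurable
    also have "\<dots> \<le> ennreal C * (Npos p (\<lambda>u. h1 u * indicator {..<t} u) + Npos p (\<lambda>u. h2 u * indicator {t<..} u))"
      by (rule C(2)) measurable
    finally show ?thesis .
  qed
  then show ?thesis using that[OF C(1)] by blast
qed

section \<open>Comparing weights against non-decreasing functions\<close>

lemma sigma_finite_lebesgue_on:
  assumes "S \<in> sets lebesgue"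
  shows "sigma_finite_measure (lebesgue_on S :: real measure)"
proof
  show "\<exists>A. countable A \<and> A \<subseteq> sets (lebesgue_on S) \<and> \<Union>A = space (lebesgue_on S) \<and>
            (\<forall>a\<in>A. emeasure (lebesgue_on S) a \<noteq> \<infinity>)"
  proof (intro exI[of _ "range (\<lambda>n::nat. S \<inter> {- real n..real n})"] conjI ballI)
    show "range (\<lambda>n::nat. S \<inter> {- real n..real n}) \<subseteq> sets (lebesgue_on S)"
      using assms by (auto simp: sets_restrict_space)
    show "(\<Union>n::nat. S \<inter> {- real n..real n}) = space (lebesgue_on S)"
    proof -
      have "\<exists>n::nat. - real n \<le> x \<and> x \<le> real n" for x
      proof -
        obtain n :: nat where "\<bar>x\<bar> \<le> real n" using real_arch_simple by blast
        then show ?thesis by (intro exI[of _ n]) (auto simp: abs_le_iff)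
      qed
      then show ?thesis by (auto simp: space_restrict_space)
    qed
    fix a assume "a \<in> range (\<lambda>n::nat. S \<inter> {- real n..real n})"
    then obtain n :: nat where a: "a = S \<inter> {- real n..real n}" by auto
    have "emeasure (lebesgue_on S) a = emeasure lebesgue a"
      using assms a by (intro emeasure_restrict_space) auto
    also have "\<dots> \<le> emeasure lebesgue {- real n..real n}"
      using assms a by (intro emeasure_mono) auto
    finally show "emeasure (lebesgue_on S) a \<noteq> \<infinity>"
      by (auto simp: top_unique)
  qed auto
qed

text \<open>
  Write $F(u)$ as the length of the interval $[0, F(u))$ and exchange the order of integration.
\<close>

lemma nn_integral_layer_cake:
  fixes w :: "'a \<Rightarrow> ennreal" and F :: "'a \<Rightarrow> real"
  assumes "sigma_finite_measure M"
    and [measurable]: "w \<in> borel_measurable M" "F \<in> borel_measurable M"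
    and nonneg: "\<And>u. u \<in> space M \<Longrightarrow> 0 \<le> F u"
  shows "(\<integral>\<^sup>+ u. w u * ennreal (F u) \<partial>M) =
    (\<integral>\<^sup>+ l. (\<integral>\<^sup>+ u. w u * indicator {u. l < F u} u \<partial>M) * indicator {0..} l \<partial>lborel)"
proof -
  interpret sigma_finite_measure M by fact
  interpret pair_sigma_finite M "lborel :: real measure" ..
  have "(\<integral>\<^sup>+ u. w u * ennreal (F u) \<partial>M) =
        (\<integral>\<^sup>+ u. (\<integral>\<^sup>+ l. w u * (indicator {u. l < F u} u * indicator {0..} l) \<partial>lborel) \<partial>M)"
  proof (rule nn_integral_cong)
    fix u assume u: "u \<in> space M"
    have "(\<integral>\<^sup>+ l. w u * (indicator {u. l < F u} u * indicator {0..} l) \<partial>lborel) =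
          (\<integral>\<^sup>+ l. w u * indicator {0..<F u} l \<partial>lborel)"
      by (intro nn_integral_cong) (auto simp: indicator_def)
    also have "\<dots> = w u * ennreal (F u)"
      using nonneg[OF u] by (simp add: nn_integral_cmult)
    finally show "w u * ennreal (F u) =
       (\<integral>\<^sup>+ l. w u * (indicator {u. l < F u} u * indicator {0..} l) \<partial>lborel)" ..
  qed
  also have "\<dots> = (\<integral>\<^sup>+ l. (\<integral>\<^sup>+ u. w u * (indicator {u. l < F u} u * indicator {0..} l) \<partial>M) \<partial>lborel)"
  proof (rule Fubini'[symmetric])
    show "(\<lambda>(u, l). w u * (indicator {u. l < F u} u * indicator {0..} l))
        \<in> borel_measurable (M \<Otimes>\<^sub>M lborel)"
      unfolding indicator_def by measurable
  qed
  also have "\<dots> = (\<integral>\<^sup>+ l. (\<integral>\<^sup>+ u. w u * indicator {u. l < F u} u \<partial>M) * indicator {0..} l \<partial>lborel)"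
  proof (rule nn_integral_cong)
    fix l :: real
    show "(\<integral>\<^sup>+ u. w u * (indicator {u. l < F u} u * indicator {0..} l) \<partial>M) =
          (\<integral>\<^sup>+ u. w u * indicator {u. l < F u} u \<partial>M) * indicator {0..} l"
      by (simp add: mult.assoc[symmetric] nn_integral_multc)
  qed
  finally show ?thesis .
qed

text \<open>
  The upper level sets of a non-decreasing function are of this form. The endpoint $0$ can occur
  only for the full half-line.
\<close>

lemma upper_set_cases:
  fixes L :: "real set"
  assumes "L \<subseteq> {0<..}" "\<And>u v. u \<in> L \<Longrightarrow> u < v \<Longrightarrow> v \<in> L"
  obtains "L = {}" | s where "0 \<le> s" "L = {s<..}" | s where "0 < s" "L = {s..}"
proof (cases "L = {}")
  case False
  have bdd: "bdd_below L" using assms(1) by (intro bdd_belowI[of _ 0]) auto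
  have le: "Inf L \<le> u" if "u \<in> L" for u using that bdd by (rule cInf_lower)
  have less: "u \<in> L" if u: "Inf L < u" for u
  proof -
    obtain v where "v \<in> L" "v < u" using u cInf_less_iff[OF False bdd] by auto
    then show ?thesis using assms(2) by blast
  qed
  have nonneg: "0 \<le> Inf L" using False assms(1) by (intro cInf_greatest) auto
  show ?thesis
  proof (cases "Inf L \<in> L")
    case True
    then have "L = {Inf L..}" using le less by (force simp: order_le_less)
    then show ?thesis using that(3)[of "Inf L"] True assms(1) by auto
  next
    case False
    then have "L = {Inf L<..}" using le less by (force simp: order_le_less)
    then show ?thesis using that(2)[of "Inf L"] nonneg by auto
  qed
qed (rule that(1))

text \<open>
  Up to a null set an upper set is an open ray. Rays starting at $0$ are not covered by the
  hypothesis on tails; they are exhausted by rays starting at positive points.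
\<close>

lemma Lq_norm_upper_set_le:
  assumes "0 < p" and [measurable]: "w0 \<in> borel_measurable half_line" "w1 \<in> borel_measurable half_line"
    and tails: "\<And>s. 0 < s \<Longrightarrow>
      Npos p (\<lambda>u. w0 u * indicator {s<..} u) \<le> Npos p (\<lambda>u. w1 u * indicator {s<..} u)"
    and L: "L \<subseteq> {0<..}" "\<And>u v. u \<in> L \<Longrightarrow> u < v \<Longrightarrow> v \<in> L"
  shows "Npos p (\<lambda>u. w0 u * indicator L u) \<le> Npos p (\<lambda>u. w1 u * indicator L u)"
proof (rule upper_set_cases[OF L])
  fix s :: real assume s: "0 < s" and L_eq: "L = {s..}"
  have "Npos p (\<lambda>u. w0 u * indicator L u) \<le> Npos p (\<lambda>u. w0 u * indicator {s<..} u)"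
    using \<open>0 < p\<close> AE_half_line_neq[of s] unfolding L_eq
    by (intro Lq_norm_mono) (auto elim!: eventually_mono simp: indicator_def)
  also have "\<dots> \<le> Npos p (\<lambda>u. w1 u * indicator {s<..} u)" by (rule tails[OF s])
  also have "\<dots> \<le> Npos p (\<lambda>u. w1 u * indicator L u)"
    using \<open>0 < p\<close> unfolding L_eq
    by (intro Lq_norm_mono) (auto simp: indicator_def)
  finally show ?thesis .
next
  fix s :: real assume s: "0 \<le> s" and L_eq: "L = {s<..}"
  show ?thesis unfolding L_eq
  proof (rule Lq_norm_le_of_truncations)
    fix d :: real assume d: "d > 0"
    have "Npos p (\<lambda>u. w0 u * indicator {s<..} u * indicator {d<..} u) =
          Npos p (\<lambda>u. w0 u * indicator {max s d<..} u)"
      by (intro arg_cong[of _ _ "Npos p"] ext) (auto simp: indicator_def)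
    also have "\<dots> \<le> Npos p (\<lambda>u. w1 u * indicator {max s d<..} u)"
      using d by (intro tails) auto
    also have "\<dots> \<le> Npos p (\<lambda>u. w1 u * indicator {s<..} u)"
      using \<open>0 < p\<close> by (intro Lq_norm_mono) (auto simp: indicator_def)
    finally show "Npos p (\<lambda>u. w0 u * indicator {s<..} u * indicator {d<..} u) \<le> 
       Npos p (\<lambda>u. w1 u * indicator {s<..} u)" .
  qed (use \<open>0 < p\<close> in measurable)
next
  assume "L = {}"
  then have "(\<lambda>u. w0 u * indicator L u) = (\<lambda>u. w1 u * indicator L u)" by (simp add: indicator_def)
  then show ?thesis by simp
qed

text \<open>
  The key comparison. If one weight is dominated by another on every ray, then it is dominated
  after multiplication by any non-decreasing function, because such a function is a superposition
  of indicators of rays. For finite $p$ the superposition is the layer cake formula for $F^p$. For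
  $p = \infty$ the level sets $\{F > q\}$ with rational $q$ suffice: there
  $w_0 \le \frac{1}{q} \|w_1 F\|_\infty$ almost everywhere, and $q$ may be taken arbitrarily close
  to $F(u)$.
\<close>

lemma Lq_norm_weighted_mono_le:
  assumes "0 < p" and w [measurable]: "w0 \<in> borel_measurable half_line" "w1 \<in> borel_measurable half_line"
    and tails: "\<And>s. 0 < s \<Longrightarrow>
      Npos p (\<lambda>u. w0 u * indicator {s<..} u) \<le> Npos p (\<lambda>u. w1 u * indicator {s<..} u)"
    and F: "mono_on {0<..} F" "\<And>u. 0 < u \<Longrightarrow> 0 \<le> (F u :: real)"
  shows "Npos p (\<lambda>u. w0 u * ennreal (F u)) \<le> Npos p (\<lambda>u. w1 u * ennreal (F u))"
proof -
  have F_meas [measurable]: "F \<in> borel_measurable half_line"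
    by (rule mono_on_borel_measurable_half_line[OF F(1)])
  show ?thesis
  proof (cases "p = \<infinity>")
    case True
    let ?M = "Npos p (\<lambda>u. w1 u * ennreal (F u))"
    have level: "AE u in half_line. q < F u \<longrightarrow> w0 u \<le> ennreal (1 / q) * ?M" if q: "0 < q" for q
    proof -
      let ?L = "{u \<in> {0<..}. q < F u}"
      have L: "?L \<in> sets half_line"
        using measurable_sets[OF F_meas, of "{q<..}"] 
        by (simp add: vimage_def space_restrict_space Int_def conj_commute)
      note [measurable] = L
      have "AE u in half_line. w1 u * indicator ?L u \<le> ennreal (1 / q) * ?M"
        using esssup_AE[of "\<lambda>u. w1 u * ennreal (F u)" half_line]
      proof eventually_elim
        case (elim u)
        have "indicator ?L u \<le> ennreal (1 / q * F u)"
          using q ennreal_leI[of 1 "1 / q * F u"] by (auto simp: indicator_def)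
        then have "w1 u * indicator ?L u \<le> w1 u * ennreal (1 / q * F u)"
          by (rule mult_left_mono) simp
        also have "\<dots> = ennreal (1 / q) * (w1 u * ennreal (F u))"
        proof -
          have "ennreal (1 / q * F u) = ennreal (1 / q) * ennreal (F u)"
            using q by (intro ennreal_mult') simp
          then show ?thesis by (simp only: mult_ac)
        qed
        also have "\<dots> \<le> ennreal (1 / q) * ?M"
          using elim unfolding True Lq_norm_top by (rule mult_left_mono) simp
        finally show ?case .
      qed
      then have "Npos p (\<lambda>u. w1 u * indicator ?L u) \<le> ennreal (1 / q) * ?M"
        unfolding True Lq_norm_top by (intro esssup_I) auto
      moreover have "Npos p (\<lambda>u. w0 u * indicator ?L u) \<le> Npos p (\<lambda>u. w1 u * indicator ?L u)"
        using F(1) by (intro Lq_norm_upper_set_le[OF assms(1) w tails]) 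
          (auto simp: mono_on_def intro: less_le_trans)
      ultimately have le: "Npos p (\<lambda>u. w0 u * indicator ?L u) \<le> ennreal (1 / q) * ?M" by simp
      show ?thesis
        using esssup_AE[of "\<lambda>u. w0 u * indicator ?L u" half_line] AE_space[of half_line]
      proof eventually_elim
        case (elim u)
        then show ?case using le unfolding True Lq_norm_top
          by (auto simp: space_restrict_space)
      qed
    qed
    have "AE u in half_line. \<forall>q\<in>\<rat>. 0 < q \<longrightarrow> q < F u \<longrightarrow> w0 u \<le> ennreal (1 / q) * ?M"
      using level by (subst AE_ball_countable[OF countable_rat]) auto
    then have "AE u in half_line. w0 u * ennreal (F u) \<le> ?M"
      using AE_space[of half_line]
    proof eventually_elim
      case (elim u)
      have Fu: "0 \<le> F u" using elim(2) F(2) by (simp add: space_restrict_space)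
      show ?case
      proof (rule ccontr)
        assume "\<not> ?case"
        then have less: "?M < w0 u * ennreal (F u)" by simp
        then have "F u \<noteq> 0" by (auto simp del: ennreal_eq_0_iff)
        then have pos: "0 < F u" using Fu by simp
        obtain m where m: "?M = ennreal m" "0 \<le> m" using less by (cases ?M) auto
        have le: "w0 u \<le> ennreal (m / q)" if "q \<in> \<rat>" "0 < q" "q < F u" for q
          using elim(1)[rule_format, OF that] m that by (simp add: ennreal_mult[symmetric])
        show False
        proof (cases "w0 u")
          case (real x)
          then have lt: "m < x * F u" using less m Fu by (simp add: ennreal_mult[symmetric] ennreal_less_iff)
          then have "0 < x" using real m(2) pos by (cases "x = 0") auto
          then have "max 0 (m / x) < F u" using lt pos by (simp add: field_simps)
          then obtain q where q: "q \<in> \<rat>" "max 0 (m / x) < q" "q < F u" using Rats_dense_in_real by blast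
          then have "0 < q" "m < q * x" using \<open>0 < x\<close> by (simp_all add: pos_divide_less_eq)
          then show False using le[of q] q real m by (simp add: field_simps)
        next
          case top
          obtain q where "q \<in> \<rat>" "0 < q" "q < F u" using Rats_dense_in_real[OF pos] by blast
          then show False using le[of q] top by (simp add: top_unique)
        qed
      qed
    qed
    then show ?thesis
      using True unfolding Lq_norm_top by (simp only: Lq_norm_top) (intro esssup_I; measurable)
  next
    case False
    then have p: "p < \<infinity>" by (simp add: less_top)
    let ?r = "enn2real p"
    let ?G = "\<lambda>u. F u powr ?r"
    note r = finite_exponent[OF assms(1) p]
    have as_layers: "(\<integral>\<^sup>+ u. epowr (w u * ennreal (F u)) ?r \<partial>half_line) =
      (\<integral>\<^sup>+ l. (\<integral>\<^sup>+ u. epowr (w u * indicator {u \<in> {0<..}. l < ?G u} u) ?r \<partial>half_line) * indicator {0..} l \<partial>lborel)"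
      if [measurable]: "w \<in> borel_measurable half_line" for w
    proof -
      have "(\<integral>\<^sup>+ u. epowr (w u * ennreal (F u)) ?r \<partial>half_line) =
            (\<integral>\<^sup>+ u. epowr (w u) ?r * ennreal (?G u) \<partial>half_line)"
        using F(2) by (intro nn_integral_cong) (auto simp: epowr_mult epowr_ennreal space_restrict_space)
      also have "\<dots> = (\<integral>\<^sup>+ l. (\<integral>\<^sup>+ u. epowr (w u) ?r * indicator {u. l < ?G u} u \<partial>half_line) * indicator {0..} l \<partial>lborel)"
        by (intro nn_integral_layer_cake sigma_finite_lebesgue_on) auto
      also have "\<dots> = (\<integral>\<^sup>+ l. (\<integral>\<^sup>+ u. epowr (w u * indicator {u \<in> {0<..}. l < ?G u} u) ?r \<partial>half_line) * indicator {0..} l \<partial>lborel)"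
        by (intro nn_integral_cong arg_cong2[of _ _ _ _ "(*)"] refl)
           (auto simp: space_restrict_space indicator_def)
      finally show ?thesis .
    qed
    have "(\<integral>\<^sup>+ u. epowr (w0 u * indicator {u \<in> {0<..}. l < ?G u} u) ?r \<partial>half_line) \<le>
          (\<integral>\<^sup>+ u. epowr (w1 u * indicator {u \<in> {0<..}. l < ?G u} u) ?r \<partial>half_line)" for l
    proof -
      have "Npos p (\<lambda>u. w0 u * indicator {u \<in> {0<..}. l < ?G u} u) \<le>
            Npos p (\<lambda>u. w1 u * indicator {u \<in> {0<..}. l < ?G u} u)"
      proof (rule Lq_norm_upper_set_le[OF assms(1) w tails])
        fix u v assume *: "u \<in> {u \<in> {0<..}. l < ?G u}" "u < v"
        then have "?G u \<le> ?G v"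
          using F r by (intro powr_mono2) (auto simp: mono_on_def)
        then show "v \<in> {u \<in> {0<..}. l < ?G u}" using * by auto
      qed auto
      then show ?thesis
        using r epowr_mono[of ?r] unfolding Lq_norm_le_iff[OF assms(1) p]
        by (simp add: Lq_norm_finite[OF p] epowr_epowr[of "1 / ?r", simplified])
    qed
    note layer_le = this
    have "(\<integral>\<^sup>+ u. epowr (w0 u * ennreal (F u)) ?r \<partial>half_line) \<le>
       (\<integral>\<^sup>+ u. epowr (w1 u * ennreal (F u)) ?r \<partial>half_line)"
      unfolding as_layers[OF w(1)] as_layers[OF w(2)]
      by (rule nn_integral_mono) (rule mult_right_mono[OF layer_le], simp)
    then show ?thesis unfolding Lq_norm_finite[OF p] using r by (intro epowr_mono) auto
  qed
qed

section \<open>Heads and tails of slowly varying weights\<close>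

abbreviation (input) weight :: "ennreal \<Rightarrow> (real \<Rightarrow> real) \<Rightarrow> real \<Rightarrow> ennreal" where
  "weight p b u \<equiv> ennreal (u powr (- recip p) * b u)"

lemma recip_nonneg: "0 \<le> recip p"
  by (simp add: recip_def)

lemma weight_measurable:
  assumes "slowly_varying b" shows "weight p b \<in> borel_measurable half_line"
proof -
  have [measurable]: "b \<in> borel_measurable half_line"
    using assms by (simp add: slowly_varying_def)
  show ?thesis by measurable
qed

text \<open>
  This one consequence of slow variation carries the rest of the argument: $\sqrt{t}\, b(t)$ is
  equivalent to a non-decreasing function. The exponent $1/2$ could be any positive number less
  than $1$.
\<close>

lemma slowly_varying_sqrt_almost_mono:
  assumes "slowly_varying b"
  obtains c :: real where "c > 0"
    "\<And>s u. 0 < s \<Longrightarrow> s \<le> u \<Longrightarrow> s powr (1 / 2) * b s \<le> c * (u powr (1 / 2) * b u)"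
proof -
  let ?f = "\<lambda>t. t powr (1 / 2) * b t"
  have b: "b t > 0" if "t > 0" for t using assms that by (simp add: slowly_varying_def)
  have half: "(1 / 2 :: real) > 0" by simp
  from assms have "\<forall>\<epsilon>>0. \<exists>g. (\<forall>t>0. g t > 0) \<and> mono_on {0<..} g \<and>
      approx_on {0<..} (\<lambda>t. ennreal (t powr \<epsilon> * b t)) (\<lambda>t. ennreal (g t))"
    unfolding slowly_varying_def by blast
  from this[rule_format, OF half] obtain g where g: "\<forall>t>0. g t > 0" "mono_on {0<..} g"
    "approx_on {0<..} (\<lambda>t. ennreal (?f t)) (\<lambda>t. ennreal (g t))"
    by blast
  from g(3) have "lesssim_on {0<..} (\<lambda>t. ennreal (?f t)) (\<lambda>t. ennreal (g t))"
    and "lesssim_on {0<..} (\<lambda>t. ennreal (g t)) (\<lambda>t. ennreal (?f t))"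
    unfolding approx_on_def by blast+
  then obtain c1 c2 where c: "c1 > 0" "c2 > 0"
    "\<And>t. t > 0 \<Longrightarrow> ennreal (?f t) \<le> ennreal c1 * ennreal (g t)"
    "\<And>t. t > 0 \<Longrightarrow> ennreal (g t) \<le> ennreal c2 * ennreal (?f t)"
    unfolding lesssim_on_def greaterThan_iff Ball_def by blast
  have fg: "?f t \<le> c1 * g t" if "t > 0" for t
  proof -
    have "0 \<le> c1 * g t" using c(1) g(1) that by (auto intro: mult_nonneg_nonneg less_imp_le)
    then show ?thesis using c(1) c(3)[OF that] by (simp add: ennreal_mult'[symmetric])
  qed
  have gf: "g t \<le> c2 * ?f t" if "t > 0" for t
  proof -
    have "0 \<le> c2 * ?f t" using c(2) b[OF that] by (auto intro: mult_nonneg_nonneg less_imp_le)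
    then show ?thesis using c(2) c(4)[OF that] by (simp add: ennreal_mult'[symmetric])
  qed
  show ?thesis
  proof (rule that[of "c1 * c2"])
    fix s u :: real assume su: "0 < s" "s \<le> u"
    have "?f s \<le> c1 * g s" using fg su by simp
    also have "\<dots> \<le> c1 * g u" using g(2) su c(1) by (auto simp: mono_on_def)
    also have "\<dots> \<le> c1 * (c2 * ?f u)" using gf su c(1) by (intro mult_left_mono) auto
    finally show "?f s \<le> c1 * c2 * ?f u" by simp
  qed (use c in simp)
qed

lemma Lq_norm_one_interval:
  assumes "0 < p" "a < b"
  shows "Lq_norm p {a<..<b} (\<lambda>_. 1) = ennreal ((b - a) powr recip p)"
proof (cases "p = \<infinity>")
  case True
  have "emeasure (lebesgue_on {a<..<b}) (space (lebesgue_on {a<..<b})) \<noteq> 0"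
    using assms by (simp add: emeasure_restrict_space space_restrict_space)
  then show ?thesis using assms(2) unfolding True Lq_norm_top recip_def
    by (simp add: esssup_const)
next
  case False
  then have p: "p < \<infinity>" by (simp add: less_top)
  have "Lq_norm p {a<..<b} (\<lambda>_. 1) = epowr (ennreal (b - a)) (1 / enn2real p)"
    unfolding Lq_norm_finite[OF p] using assms(2)
    by (simp add: emeasure_restrict_space space_restrict_space)
  then show ?thesis using assms(2) False by (simp add: recip_def epowr_ennreal)
qed

lemma Lq_norm_indicator_interval:
  assumes "0 < p" "0 \<le> a" "a < b"
  shows "Npos p (indicator {a<..<b}) = ennreal ((b - a) powr recip p)"
proof -
  have "{a<..<b} \<subseteq> {0<..}" using assms(2) by auto
  then show ?thesis
    using Lq_norm_subset[of p "{0<..}" "{a<..<b}" "\<lambda>_. 1"] assms Lq_norm_one_interval[of p a b]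
    by simp
qed

text \<open>
  By scaling the left-hand side does not depend on $t$; for finite $p = r$ it equals
  $(\int_0^1 u^{r/2 - 1}\,du)^{1/r} = (2/r)^{1/r}$.
\<close>

lemma Lq_norm_power_weight_finite:
  assumes "0 < p"
  obtains D :: real where "D \<ge> 0"
    "\<And>t. t > 0 \<Longrightarrow>
      Npos p (\<lambda>u. ennreal (u powr (- recip p) * (u / t) powr (1 / 2)) * indicator {..<t} u) \<le> ennreal D"
proof (cases "p = \<infinity>")
  case True
  have "Npos p (\<lambda>u. ennreal (u powr (- recip p) * (u / t) powr (1 / 2)) * indicator {..<t} u) \<le> ennreal 1"
    if "t > 0" for t
    unfolding True Lq_norm_top
  proof (rule esssup_I)
    show "AE u in half_line. ennreal (u powr (- recip \<infinity>) * (u / t) powr (1 / 2)) * indicator {..<t} u \<le> ennreal 1"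
    proof (rule AE_I2)
      fix u :: real assume "u \<in> space half_line"
      then have u: "u > 0" by (simp add: space_restrict_space)
      show "ennreal (u powr (- recip \<infinity>) * (u / t) powr (1 / 2)) * indicator {..<t} u \<le> ennreal 1"
        using u \<open>t > 0\<close> powr_mono2[of "1/2" "u / t" 1]
        by (auto simp: recip_def indicator_def ennreal_le_1)
    qed
  qed measurable
  then show ?thesis using that[of 1] by simp
next
  case False
  then have p: "p < \<infinity>" by (simp add: less_top)
  let ?r = "enn2real p"
  note r = finite_exponent[OF assms(1) p]
  have "Npos p (\<lambda>u. ennreal (u powr (- recip p) * (u / t) powr (1 / 2)) * indicator {..<t} u)
      \<le> ennreal ((2 / ?r) powr (1 / ?r))" if t: "t > 0" for t
  proof -
    let ?h = "\<lambda>u. t powr (- ?r / 2) * u powr (?r / 2 - 1)"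
    have "((\<lambda>u. u powr (?r / 2 - 1)) has_integral (t powr (?r / 2) / (?r / 2))) {0..t}"
      using has_integral_powr_from_0[of "?r / 2 - 1" t] r t by simp
    then have "(?h has_integral (t powr (- ?r / 2) * (t powr (?r / 2) / (?r / 2)))) {0..t}"
      by (rule has_integral_mult_right)
    also have "t powr (- ?r / 2) * (t powr (?r / 2) / (?r / 2)) = 2 / ?r"
      using t by (simp add: powr_minus)
    finally have h: "(?h has_integral (2 / ?r)) {0..t}" .
    have "(\<integral>\<^sup>+ u. epowr (ennreal (u powr (- recip p) * (u / t) powr (1 / 2)) * indicator {..<t} u) ?r \<partial>half_line)
        = (\<integral>\<^sup>+ u. epowr (ennreal (u powr (- recip p) * (u / t) powr (1 / 2)) * indicator {..<t} u) ?r * indicator {0<..} u \<partial>lebesgue)"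
      by (subst nn_integral_restrict_space) auto
    also have "\<dots> = (\<integral>\<^sup>+ u. ennreal (?h u) * indicator {0<..<t} u \<partial>lebesgue)"
    proof (rule nn_integral_cong)
      fix u :: real
      have "(u powr (- recip p) * (u / t) powr (1 / 2)) powr ?r = ?h u" if u: "u > 0"
      proof -
        have "(u powr (- recip p) * (u / t) powr (1 / 2)) powr ?r = u powr (- 1) * (u / t) powr (?r / 2)"
          using u t r False by (simp add: powr_mult powr_powr recip_def)
        also have "\<dots> = (u powr (- 1) * u powr (?r / 2)) * t powr (- ?r / 2)"
          using u t by (simp add: powr_divide powr_minus divide_simps)
        also have "u powr (- 1) * u powr (?r / 2) = u powr (?r / 2 - 1)"
          by (subst powr_add[symmetric]) (simp add: algebra_simps)
        finally show ?thesis by simp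
      qed
      then show "epowr (ennreal (u powr (- recip p) * (u / t) powr (1 / 2)) * indicator {..<t} u) ?r * indicator {0<..} u
          = ennreal (?h u) * indicator {0<..<t} u"
        by (auto simp: indicator_def epowr_ennreal)
    qed
    also have "\<dots> \<le> (\<integral>\<^sup>+ u. ennreal (?h u) * indicator {0..t} u \<partial>lebesgue)"
      by (intro nn_integral_mono) (auto simp: indicator_def)
    also have "\<dots> = (\<integral>\<^sup>+ u. ennreal (?h u) * indicator {0..t} u \<partial>lborel)"
      by (rule nn_integral_completion)
    also have "\<dots> = ennreal (2 / ?r)"
      by (rule nn_integral_has_integral_lebesgue'[OF _ h]) auto
    finally have "(\<integral>\<^sup>+ u. epowr (ennreal (u powr (- recip p) * (u / t) powr (1 / 2)) * indicator {..<t} u) ?r \<partial>half_line)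
        \<le> ennreal (2 / ?r)" .
    from epowr_mono[OF _ this, of "1 / ?r"] show ?thesis
      unfolding Lq_norm_finite[OF p] using r by (simp add: epowr_ennreal)
  qed
  then show ?thesis using that[of "(2 / ?r) powr (1 / ?r)"] by simp
qed

text \<open>
  On $(t, 2t)$ the function $b$ is bounded below by a multiple of $b(t)$, and the measure $du/u$
  gives this interval a mass independent of $t$.
\<close>

lemma tail_lower_bound:
  assumes "0 < p" "slowly_varying b"
  obtains c :: real where "c > 0"
    "\<And>t. t > 0 \<Longrightarrow> ennreal (b t) \<le> ennreal c * Npos p (\<lambda>u. weight p b u * indicator {t<..} u)"
proof -
  have b: "b t > 0" if "t > 0" for t using assms that by (simp add: slowly_varying_def)
  note weight_measurable[OF assms(2), measurable]
  obtain k where k: "k > 0"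
    "\<And>s u. 0 < s \<Longrightarrow> s \<le> u \<Longrightarrow> s powr (1 / 2) * b s \<le> k * (u powr (1 / 2) * b u)"
    using slowly_varying_sqrt_almost_mono[OF assms(2)] by blast
  (* 2 k comes from sqrt (2 t) < 2 sqrt t, the power of 2 from the weight u powr (- recip p) at u = 2 t *)
  define c where "c = k * 2 * 2 powr recip p"
  have "ennreal (b t) \<le> ennreal c * Npos p (\<lambda>u. weight p b u * indicator {t<..} u)" if t: "t > 0" for t
  proof -
    have bt: "b t \<le> 2 * k * b u" if u: "t < u" "u < 2 * t" for u
    proof -
      have "t powr (1 / 2) * b t \<le> k * (u powr (1 / 2) * b u)" using k(2) t u by simp
      also have "u powr (1 / 2) \<le> (4 * t) powr (1 / 2)" using t u by (intro powr_mono2) auto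
      also have "(4 * t) powr (1 / 2) = 2 * t powr (1 / 2)" using t by (simp add: powr_mult powr_half_sqrt)
      finally have "t powr (1 / 2) * b t \<le> t powr (1 / 2) * (2 * k * b u)"
        using k(1) b[of u] t u by (simp add: mult_ac)
      then show ?thesis using t by simp
    qed
    have pw: "indicator {t<..<2 * t} u \<le>
        ennreal (c * t powr recip p / b t) * (weight p b u * indicator {t<..} u)" for u
    proof (cases "u \<in> {t<..<2 * t}")
      case True
      then have u: "t < u" "u < 2 * t" by auto
      have "u powr recip p \<le> (2 * t) powr recip p" using t u recip_nonneg by (intro powr_mono2) auto
      also have "\<dots> = 2 powr recip p * t powr recip p" using t by (simp add: powr_mult)
      finally have "1 \<le> 2 powr recip p * t powr recip p * u powr (- recip p)"
        using t u by (simp add: powr_minus field_simps)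
      then have "b t * 1 \<le> (2 * k * b u) * (2 powr recip p * t powr recip p * u powr (- recip p))"
        using bt[OF u] b[of t] b[of u] t u k(1) by (intro mult_mono) auto
      then have "b t \<le> c * t powr recip p * (u powr (- recip p) * b u)"
        by (simp add: c_def mult_ac)
      then have "1 \<le> c * t powr recip p / b t * (u powr (- recip p) * b u)"
        using b[OF t] by (simp add: field_simps)
      from ennreal_leI[OF this] show ?thesis
        using u k(1) c_def b[of u] b[of t] t by (simp add: ennreal_mult[symmetric])
    qed simp
    have "ennreal (t powr recip p) = Npos p (indicator {t<..<2 * t})"
      using Lq_norm_indicator_interval[OF assms(1), of t "2 * t"] t by simp
    also have "\<dots> \<le> Npos p (\<lambda>u. ennreal (c * t powr recip p / b t) * (weight p b u * indicator {t<..} u))"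
      using assms(1) pw by (intro Lq_norm_mono) auto
    also have "\<dots> \<le> ennreal (c * t powr recip p / b t) * Npos p (\<lambda>u. weight p b u * indicator {t<..} u)"
      by (rule Lq_norm_cmult[OF assms(1)]) measurable
    finally have "ennreal (b t / t powr recip p) * ennreal (t powr recip p) \<le> ennreal (b t / t powr recip p) *
        (ennreal (c * t powr recip p / b t) * Npos p (\<lambda>u. weight p b u * indicator {t<..} u))"
      by (rule mult_left_mono) simp
    then show ?thesis
      using t b[OF t] k(1) c_def by (simp add: mult.assoc[symmetric] ennreal_mult[symmetric])
  qed
  then show ?thesis using that[of c] k(1) by (simp add: c_def)
qed

text \<open>
  Below $t$ the factor $u/t$ turns the weight into an increasing power: $b(u)\,u/t$ is bounded by a
  multiple of $b(t) \sqrt{u/t}$, so the quasi-norm over $(0,t)$ is controlled by $b(t)$, hence by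
  the tail. This estimate makes the linear part $K(u, g) \le u \|g\|_{A_1}$ of a $K$-functional
  negligible near $0$.
\<close>

lemma head_le_tail:
  assumes "0 < p" "slowly_varying b"
  obtains c :: real where "c \<ge> 0"
    "\<And>t. t > 0 \<Longrightarrow>
       Npos p (\<lambda>u. weight p b u * ennreal (u / t) * indicator {..<t} u)
       \<le> ennreal c * Npos p (\<lambda>u. weight p b u * indicator {t<..} u)"
proof -
  have b: "b t > 0" if "t > 0" for t using assms that by (simp add: slowly_varying_def)
  note weight_measurable[OF assms(2), measurable]
  obtain k where k: "k > 0"
    "\<And>s u. 0 < s \<Longrightarrow> s \<le> u \<Longrightarrow> s powr (1 / 2) * b s \<le> k * (u powr (1 / 2) * b u)"
    using slowly_varying_sqrt_almost_mono[OF assms(2)] by blast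
  obtain D where D: "D \<ge> 0" "\<And>t. t > 0 \<Longrightarrow>
      Npos p (\<lambda>u. ennreal (u powr (- recip p) * (u / t) powr (1 / 2)) * indicator {..<t} u) \<le> ennreal D"
    using Lq_norm_power_weight_finite[OF assms(1)] by blast
  obtain c where c: "c > 0"
    "\<And>t. t > 0 \<Longrightarrow> ennreal (b t) \<le> ennreal c * Npos p (\<lambda>u. weight p b u * indicator {t<..} u)"
    using tail_lower_bound[OF assms] by blast
  have "Npos p (\<lambda>u. weight p b u * ennreal (u / t) * indicator {..<t} u)
       \<le> ennreal (k * D * c) * Npos p (\<lambda>u. weight p b u * indicator {t<..} u)" if t: "t > 0" for t
  proof -
    let ?h = "\<lambda>u. ennreal (u powr (- recip p) * (u / t) powr (1 / 2)) * indicator {..<t} u"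
    have pw: "weight p b u * ennreal (u / t) * indicator {..<t} u \<le> ennreal (k * b t) * ?h u" if u: "u > 0" for u
    proof (cases "u < t")
      case True
      have "u powr (1 / 2) * b u \<le> k * (t powr (1 / 2) * b t)" using k(2) u True by simp
      then have "u powr (1 / 2) / t powr (1 / 2) * (u powr (1 / 2) * b u) \<le>
          u powr (1 / 2) / t powr (1 / 2) * (k * (t powr (1 / 2) * b t))"
        by (rule mult_left_mono) simp
      moreover have "u powr (1 / 2) * u powr (1 / 2) = u" "t powr (1 / 2) * t powr (1 / 2) = t"
        using u t by (simp_all add: powr_add[symmetric])
      ultimately have "u / t powr (1 / 2) * b u \<le> u powr (1 / 2) * (k * b t)"
        using t by (simp add: field_simps)
      then have "u / t powr (1 / 2) * b u / t powr (1 / 2) \<le> u powr (1 / 2) * (k * b t) / t powr (1 / 2)"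
        by (rule divide_right_mono) simp
      then have "u / t * b u \<le> k * b t * (u / t) powr (1 / 2)"
        using \<open>t powr (1 / 2) * t powr (1 / 2) = t\<close> u t by (simp add: powr_divide mult_ac)
      then have "u powr (- recip p) * (u / t * b u) \<le> u powr (- recip p) * (k * b t * (u / t) powr (1 / 2))"
        by (rule mult_left_mono) simp
      then have "(u powr (- recip p) * b u) * (u / t) \<le> k * b t * (u powr (- recip p) * (u / t) powr (1 / 2))"
        by (simp add: mult_ac)
      from ennreal_leI[OF this] show ?thesis
        using True k(1) u t b[of u] b[of t] by (simp add: ennreal_mult[symmetric])
    qed simp
    have "Npos p (\<lambda>u. weight p b u * ennreal (u / t) * indicator {..<t} u) \<le> Npos p (\<lambda>u. ennreal (k * b t) * ?h u)"
      using pw by (intro Lq_norm_mono[OF assms(1)]) (auto intro!: AE_I2 simp: space_restrict_space)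
    also have "\<dots> \<le> ennreal (k * b t) * Npos p ?h"
      by (rule Lq_norm_cmult[OF assms(1)]) measurable
    also have "\<dots> \<le> ennreal (k * b t) * ennreal D"
      by (intro mult_left_mono D(2) t) simp
    also have "\<dots> = ennreal (k * D) * ennreal (b t)"
      using k(1) D(1) b[OF t] by (simp add: ennreal_mult[symmetric] mult_ac)
    also have "\<dots> \<le> ennreal (k * D) * (ennreal c * Npos p (\<lambda>u. weight p b u * indicator {t<..} u))"
      by (intro mult_left_mono c(2) t) simp
    also have "\<dots> = ennreal (k * D * c) * Npos p (\<lambda>u. weight p b u * indicator {t<..} u)"
      using k(1) D(1) c(1) by (simp add: ennreal_mult mult_ac)
    finally show ?thesis .
  qed
  then show ?thesis using that[of "k * D * c"] k(1) D(1) c(1) by simp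
qed

lemma tail_positive:
  assumes "0 < p" "slowly_varying b" "t > 0"
  shows "0 < Npos p (\<lambda>u. weight p b u * indicator {t<..} u)"
proof -
  have b: "b t > 0" using assms by (simp add: slowly_varying_def)
  obtain c where "ennreal (b t) \<le> ennreal c * Npos p (\<lambda>u. weight p b u * indicator {t<..} u)"
    using tail_lower_bound[OF assms(1,2)] assms(3) by blast
  with b show ?thesis
    by (cases "Npos p (\<lambda>u. weight p b u * indicator {t<..} u) = 0") (auto simp: zero_less_iff_neq_zero)
qed

text \<open>
  Membership in $SV_{0,p}$ controls the weight on $(1,\infty)$, and almost monotonicity bounds it
  on $(t, 1]$.
\<close>

lemma tail_finite:
  assumes "0 < p" "b \<in> SV0 p" "t > 0"
  shows "Npos p (\<lambda>u. weight p b u * indicator {t<..} u) < \<infinity>"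
proof -
  have sv: "slowly_varying b" and fin: "Lq_norm p {1<..} (weight p b) < \<infinity>"
    using assms(2) by (auto simp: SV0_def)
  have b: "b t > 0" if "t > 0" for t using sv that by (simp add: slowly_varying_def)
  note weight_measurable[OF sv, measurable]
  obtain k where k: "k > 0"
    "\<And>s u. 0 < s \<Longrightarrow> s \<le> u \<Longrightarrow> s powr (1 / 2) * b s \<le> k * (u powr (1 / 2) * b u)"
    using slowly_varying_sqrt_almost_mono[OF sv] by blast
  obtain C where C: "\<And>S g h. g \<in> borel_measurable (lebesgue_on S) \<Longrightarrow> h \<in> borel_measurable (lebesgue_on S) \<Longrightarrow>
       Lq_norm p S (\<lambda>u. g u + h u) \<le> ennreal C * (Lq_norm p S g + Lq_norm p S h)"
    using Lq_norm_quasi_triangle[OF assms(1)] by metis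
  (* d bounds the weight on the interval from t to 1 *)
  define d where "d = t powr (- recip p) * (k * b 1 / t powr (1 / 2))"
  let ?g = "\<lambda>u. ennreal d * indicator {0<..<2} u"
  let ?h = "\<lambda>u. weight p b u * indicator {1<..} u"
  have pw: "weight p b u * indicator {t<..} u \<le> ?g u + ?h u" if u: "u > 0" for u
  proof (cases "t < u \<and> u \<le> 1")
    case True
    have "t powr (1 / 2) * b u \<le> u powr (1 / 2) * b u"
      using True assms(3) b[OF u] by (intro mult_right_mono powr_mono2) auto
    also have "\<dots> \<le> k * b 1" using k(2)[of u 1] u True by simp
    finally have "b u \<le> k * b 1 / t powr (1 / 2)" using assms(3) by (simp add: field_simps)
    moreover have "u powr (- recip p) \<le> t powr (- recip p)"
      using True assms(3) recip_nonneg by (intro powr_mono2') auto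
    ultimately have "u powr (- recip p) * b u \<le> d"
      unfolding d_def using b[OF u] by (intro mult_mono) auto
    then show ?thesis using True u by (simp add: ennreal_leI)
  qed (auto simp: indicator_def)
  have "Npos p (\<lambda>u. weight p b u * indicator {t<..} u) \<le> Npos p (\<lambda>u. ?g u + ?h u)"
    using pw by (intro Lq_norm_mono[OF assms(1)]) (auto intro!: AE_I2 simp: space_restrict_space)
  also have "\<dots> \<le> ennreal C * (Npos p ?g + Npos p ?h)"
    by (rule C) measurable
  also have "\<dots> < \<infinity>"
  proof -
    have "Npos p ?g \<le> ennreal d * Npos p (indicator {0<..<2})"
      by (rule Lq_norm_cmult[OF assms(1)]) measurable
    also have "\<dots> < \<infinity>"
      using Lq_norm_indicator_interval[OF assms(1), of 0 2] by (simp add: ennreal_mult_less_top)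
    finally have "Npos p ?g < \<infinity>" .
    moreover have "Npos p ?h < \<infinity>"
      using Lq_norm_subset[of p "{0<..}" "{1<..}" "weight p b"] assms(1) fin by auto
    ultimately show ?thesis by (simp add: ennreal_mult_less_top)
  qed
  finally show ?thesis .
qed

section \<open>Basic properties of the $K$-functional\<close>

lemma quasi_normedD:
  assumes "quasi_normed A"
  shows "0 \<in> space_of A" "qnorm A 0 = 0"
    "x \<in> space_of A \<Longrightarrow> 0 \<le> qnorm A x"
    "x \<in> space_of A \<Longrightarrow> y \<in> space_of A \<Longrightarrow> x + y \<in> space_of A"
    "x \<in> space_of A \<Longrightarrow> - x \<in> space_of A"
    "x \<in> space_of A \<Longrightarrow> qnorm A (- x) = qnorm A x"
proof -
  show "0 \<in> space_of A" "qnorm A 0 = 0" "x \<in> space_of A \<Longrightarrow> 0 \<le> qnorm A x"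
    "x \<in> space_of A \<Longrightarrow> y \<in> space_of A \<Longrightarrow> x + y \<in> space_of A"
    "x \<in> space_of A \<Longrightarrow> - x \<in> space_of A"
    using assms by (auto simp: quasi_normed_def subspace_0 subspace_add subspace_neg)
  have "qnorm A ((- 1) *\<^sub>R x) = \<bar>- 1\<bar> * qnorm A x" if "x \<in> space_of A"
    using assms that unfolding quasi_normed_def by blast
  then show "x \<in> space_of A \<Longrightarrow> qnorm A (- x) = qnorm A x" by simp
qed

lemma K_fun_le:
  assumes "f0 \<in> space_of A0" "f1 \<in> space_of A1"
  shows "K_fun t (f0 + f1) A0 A1 \<le> ennreal (qnorm A0 f0 + t * qnorm A1 f1)"
  unfolding K_fun_def using assms by (intro Inf_lower) blast

lemma K_fun_less_decomposition:
  assumes "K_fun t f A0 A1 < ennreal M"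
  obtains f0 f1 where "f0 \<in> space_of A0" "f1 \<in> space_of A1" "f = f0 + f1"
    "qnorm A0 f0 + t * qnorm A1 f1 < M"
proof -
  obtain f0 f1 where f: "f0 \<in> space_of A0" "f1 \<in> space_of A1" "f = f0 + f1"
    "ennreal (qnorm A0 f0 + t * qnorm A1 f1) < ennreal M"
    using assms unfolding K_fun_def by (auto simp: Inf_less_iff)
  then show ?thesis using that ennreal_leI not_le by metis
qed

lemma K_fun_finite:
  assumes "f \<in> sum_space A0 A1" shows "K_fun t f A0 A1 < top"
proof -
  obtain f0 f1 where "f0 \<in> space_of A0" "f1 \<in> space_of A1" "f = f0 + f1"
    using assms unfolding sum_space_def by blast
  then show ?thesis using le_less_trans[OF K_fun_le ennreal_less_top] by blast
qed

lemma K_fun_mono: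
  assumes "quasi_normed A1" "s \<le> t"
  shows "K_fun s f A0 A1 \<le> K_fun t f A0 A1"
  unfolding K_fun_def[of t]
proof (rule Inf_greatest, clarify)
  fix f0 f1 assume f: "f0 \<in> space_of A0" "f1 \<in> space_of A1"
  have "K_fun s (f0 + f1) A0 A1 \<le> ennreal (qnorm A0 f0 + s * qnorm A1 f1)" by (rule K_fun_le[OF f])
  also have "\<dots> \<le> ennreal (qnorm A0 f0 + t * qnorm A1 f1)"
    using quasi_normedD(3)[OF assms(1) f(2)] assms(2) by (intro ennreal_leI add_left_mono mult_right_mono)
  finally show "K_fun s (f0 + f1) A0 A1 \<le> ennreal (qnorm A0 f0 + t * qnorm A1 f1)" .
qed

lemma K_fun_quasi_triangle:
  fixes A0 A1 :: "'a::real_vector qspace"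
  assumes q: "quasi_normed A0" "quasi_normed A1"
  obtains C :: real where "C \<ge> 1"
    "\<And>t f g. 0 < t \<Longrightarrow> K_fun t (f + g) A0 A1 \<le> ennreal C * (K_fun t f A0 A1 + K_fun t g A0 A1)"
proof -
  have ex: "\<exists>C\<ge>1. \<forall>x\<in>space_of A. \<forall>y\<in>space_of A. qnorm A (x + y) \<le> C * (qnorm A x + qnorm A y)"
    if "quasi_normed A" for A :: "'a qspace"
    using that by (simp add: quasi_normed_def)
  obtain C0 C1 where C: "C0 \<ge> 1" "C1 \<ge> 1"
    "\<forall>x\<in>space_of A0. \<forall>y\<in>space_of A0. qnorm A0 (x + y) \<le> C0 * (qnorm A0 x + qnorm A0 y)"
    "\<forall>x\<in>space_of A1. \<forall>y\<in>space_of A1. qnorm A1 (x + y) \<le> C1 * (qnorm A1 x + qnorm A1 y)"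
    using ex[OF q(1)] ex[OF q(2)] by blast
  define C where "C = max C0 C1"
  have "K_fun t (f + g) A0 A1 \<le> ennreal C * (K_fun t f A0 A1 + K_fun t g A0 A1)" if t: "0 < t" for t f g
    unfolding K_fun_def[of t f] K_fun_def[of t g]
  proof (rule le_mult_add_Inf)
    show "0 < C" using C(1) by (simp add: C_def)
    fix a b
    assume "a \<in> {ennreal (qnorm A0 f0 + t * qnorm A1 f1) |f0 f1. f0 \<in> space_of A0 \<and> f1 \<in> space_of A1 \<and> f = f0 + f1}"
      and "b \<in> {ennreal (qnorm A0 f0 + t * qnorm A1 f1) |f0 f1. f0 \<in> space_of A0 \<and> f1 \<in> space_of A1 \<and> g = f0 + f1}"
    then obtain f0 f1 g0 g1 where f: "f0 \<in> space_of A0" "f1 \<in> space_of A1" "f = f0 + f1"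
      and g: "g0 \<in> space_of A0" "g1 \<in> space_of A1" "g = g0 + g1"
      and a: "a = ennreal (qnorm A0 f0 + t * qnorm A1 f1)"
      and b: "b = ennreal (qnorm A0 g0 + t * qnorm A1 g1)" by blast
    note nn = quasi_normedD(3)[OF q(1) f(1)] quasi_normedD(3)[OF q(2) f(2)]
      quasi_normedD(3)[OF q(1) g(1)] quasi_normedD(3)[OF q(2) g(2)]
    have "qnorm A0 (f0 + g0) \<le> C * (qnorm A0 f0 + qnorm A0 g0)"
      using C(3)[rule_format, OF f(1) g(1)] nn mult_right_mono[of C0 C "qnorm A0 f0 + qnorm A0 g0"]
      by (simp add: C_def)
    moreover have "qnorm A1 (f1 + g1) \<le> C * (qnorm A1 f1 + qnorm A1 g1)"
      using C(4)[rule_format, OF f(2) g(2)] nn mult_right_mono[of C1 C "qnorm A1 f1 + qnorm A1 g1"]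
      by (simp add: C_def)
    ultimately have "qnorm A0 (f0 + g0) + t * qnorm A1 (f1 + g1) \<le>
        C * (qnorm A0 f0 + qnorm A0 g0) + t * (C * (qnorm A1 f1 + qnorm A1 g1))"
      using t by (intro add_mono mult_left_mono) auto
    also have "\<dots> = C * ((qnorm A0 f0 + t * qnorm A1 f1) + (qnorm A0 g0 + t * qnorm A1 g1))"
      by (simp add: algebra_simps)
    finally have le: "ennreal (qnorm A0 (f0 + g0) + t * qnorm A1 (f1 + g1)) \<le> ennreal C * (a + b)"
      unfolding a b using C(1) nn t
      by (simp add: C_def ennreal_mult[symmetric] ennreal_plus[symmetric] ennreal_leI del: ennreal_plus)
    have "K_fun t ((f0 + g0) + (f1 + g1)) A0 A1 \<le> ennreal (qnorm A0 (f0 + g0) + t * qnorm A1 (f1 + g1))"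
      by (intro K_fun_le quasi_normedD(4) q f g)
    also have "(f0 + g0) + (f1 + g1) = f + g" using f(3) g(3) by simp
    finally show "K_fun t (f + g) A0 A1 \<le> ennreal C * (a + b)" using le by simp
  qed
  then show ?thesis using that[of C] C(1) by (simp add: C_def)
qed

text \<open>
  Packages the $K$-functional of an element of the sum as a real non-decreasing function, the form
  required by the comparison of weights.
\<close>

lemma K_fun_monotone_real:
  assumes "quasi_normed A1" "f \<in> sum_space A0 A1"
  obtains k :: "real \<Rightarrow> real" where "mono_on {0<..} k" "\<And>u. 0 \<le> k u"
    "(\<lambda>u. K_fun u f A0 A1) = (\<lambda>u. ennreal (k u))"
proof
  show "mono_on {0<..} (\<lambda>u. enn2real (K_fun u f A0 A1))"
    using K_fun_mono[OF assms(1)] K_fun_finite[OF assms(2)] by (intro mono_onI enn2real_mono) auto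
qed (use K_fun_finite[OF assms(2)] in auto)

lemma K_fun_measurable:
  assumes "quasi_normed A1" "f \<in> sum_space A0 A1"
  shows "(\<lambda>u. K_fun u f A0 A1) \<in> borel_measurable half_line"
proof -
  obtain k :: "real \<Rightarrow> real" where k: "mono_on {0<..} k" "(\<lambda>u. K_fun u f A0 A1) = (\<lambda>u. ennreal (k u))"
    using K_fun_monotone_real[OF assms] by blast
  show ?thesis unfolding k(2) using mono_on_borel_measurable_half_line[OF k(1)] by measurable
qed

lemma interp_norm_eq:
  "interp_norm 0 p b A0 A1 f = Npos p (\<lambda>u. weight p b u * K_fun u f A0 A1)"
  by (simp add: interp_norm_def)

section \<open>The lower estimate\<close>

text \<open>
  Absorbs the weight of the other space on the head. On a ray $(s, \infty)$ with $s < t$ the truncated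
  weight $w_0 \chi_{(0,t)}$ has norm at most $R(s) \|w_1\|_{(s,\infty)} \le R(t)
  \|w_1\|_{(s,\infty)}$, since $R$ is non-decreasing; for $s \ge t$ it vanishes.
\<close>

lemma head_le_rho:
  fixes R F :: "real \<Rightarrow> real"
  assumes p: "0 < p" and w: "w0 \<in> borel_measurable half_line" "w1 \<in> borel_measurable half_line"
    and R: "mono_on {0<..} R" "\<And>s. 0 < s \<Longrightarrow> 0 < R s"
      "\<And>s. 0 < s \<Longrightarrow> Npos p (\<lambda>u. w0 u * indicator {s<..} u) = ennreal (R s) * Npos p (\<lambda>u. w1 u * indicator {s<..} u)"
    and F: "mono_on {0<..} F" "\<And>u. 0 \<le> F u"
    and t: "0 < t"
  shows "Npos p (\<lambda>u. w0 u * ennreal (F u) * indicator {..<t} u) \<le> ennreal (R t) * Npos p (\<lambda>u. w1 u * ennreal (F u))"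
proof -
  note w [measurable] mono_on_borel_measurable_half_line[OF F(1), measurable]
  have "Npos p (\<lambda>u. w0 u * ennreal (F u) * indicator {..<t} u) = Npos p (\<lambda>u. (w0 u * indicator {..<t} u) * ennreal (F u))"
    by (simp only: mult_ac)
  also have "\<dots> \<le> Npos p (\<lambda>u. (ennreal (R t) * w1 u) * ennreal (F u))"
  proof (rule Lq_norm_weighted_mono_le[OF p _ _ _ F])
    fix s :: real assume s: "0 < s"
    show "Npos p (\<lambda>u. w0 u * indicator {..<t} u * indicator {s<..} u) \<le>
          Npos p (\<lambda>u. ennreal (R t) * w1 u * indicator {s<..} u)"
    proof (cases "s < t")
      case True
      have "Npos p (\<lambda>u. w0 u * indicator {..<t} u * indicator {s<..} u) \<le> Npos p (\<lambda>u. w0 u * indicator {s<..} u)"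
        by (intro Lq_norm_mono[OF p]) (auto simp: indicator_def)
      also have "\<dots> = ennreal (R s) * Npos p (\<lambda>u. w1 u * indicator {s<..} u)" by (rule R(3)[OF s])
      also have "\<dots> \<le> ennreal (R t) * Npos p (\<lambda>u. w1 u * indicator {s<..} u)"
        using R(1) s True by (intro mult_right_mono ennreal_leI) (auto simp: mono_on_def)
      also have "\<dots> = Npos p (\<lambda>u. ennreal (R t) * (w1 u * indicator {s<..} u))"
        by (rule Lq_norm_cmult_eq[symmetric, OF p _ R(2)[OF t]]) measurable
      finally show ?thesis by (simp only: mult_ac)
    next
      case False
      then show ?thesis by (intro Lq_norm_mono[OF p]) (auto simp: indicator_def)
    qed
  qed measurable
  also have "\<dots> = Npos p (\<lambda>u. ennreal (R t) * (w1 u * ennreal (F u)))" by (simp only: mult_ac)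
  also have "\<dots> = ennreal (R t) * Npos p (\<lambda>u. w1 u * ennreal (F u))"
    by (rule Lq_norm_cmult_eq[OF p _ R(2)[OF t]]) measurable
  finally show ?thesis .
qed

text \<open>
  The counterpart on the tail. On a ray $(s,\infty)$ the weight $w_1 \chi_{(t,\infty)}$ has the
  norm of $w_1$ over $(m, \infty)$ with $m = \max(s,t)$, and $R(t) \|w_1\|_{(m,\infty)} \le R(m)
  \|w_1\|_{(m,\infty)} = \|w_0\|_{(m,\infty)}$.
\<close>

lemma rho_tail_le:
  fixes R F :: "real \<Rightarrow> real"
  assumes p: "0 < p" and w: "w0 \<in> borel_measurable half_line" "w1 \<in> borel_measurable half_line"
    and R: "mono_on {0<..} R" "\<And>s. 0 < s \<Longrightarrow> 0 < R s"
      "\<And>s. 0 < s \<Longrightarrow> Npos p (\<lambda>u. w0 u * indicator {s<..} u) = ennreal (R s) * Npos p (\<lambda>u. w1 u * indicator {s<..} u)"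
    and F: "mono_on {0<..} F" "\<And>u. 0 \<le> F u"
    and t: "0 < t"
  shows "ennreal (R t) * Npos p (\<lambda>u. w1 u * ennreal (F u) * indicator {t<..} u) \<le> Npos p (\<lambda>u. w0 u * ennreal (F u))"
proof -
  note w [measurable] mono_on_borel_measurable_half_line[OF F(1), measurable]
  have "ennreal (R t) * Npos p (\<lambda>u. w1 u * ennreal (F u) * indicator {t<..} u) =
        Npos p (\<lambda>u. ennreal (R t) * (w1 u * ennreal (F u) * indicator {t<..} u))"
    by (rule Lq_norm_cmult_eq[symmetric, OF p _ R(2)[OF t]]) measurable
  also have "\<dots> = Npos p (\<lambda>u. ennreal (R t) * (w1 u * indicator {t<..} u) * ennreal (F u))"
    by (simp only: mult_ac)
  also have "\<dots> \<le> Npos p (\<lambda>u. w0 u * ennreal (F u))"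
  proof (rule Lq_norm_weighted_mono_le[OF p _ _ _ F])
    fix s :: real assume s: "0 < s"
    let ?m = "max s t"
    have "Npos p (\<lambda>u. ennreal (R t) * (w1 u * indicator {t<..} u) * indicator {s<..} u) =
          Npos p (\<lambda>u. ennreal (R t) * (w1 u * indicator {?m<..} u))"
      by (intro arg_cong[of _ _ "Npos p"] ext) (auto simp: indicator_def)
    also have "\<dots> = ennreal (R t) * Npos p (\<lambda>u. w1 u * indicator {?m<..} u)"
      by (rule Lq_norm_cmult_eq[OF p _ R(2)[OF t]]) measurable
    also have "\<dots> \<le> ennreal (R ?m) * Npos p (\<lambda>u. w1 u * indicator {?m<..} u)"
      using R(1) s t by (intro mult_right_mono ennreal_leI) (auto simp: mono_on_def)
    also have "\<dots> = Npos p (\<lambda>u. w0 u * indicator {?m<..} u)" using R(3)[of ?m] s by simp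
    also have "\<dots> \<le> Npos p (\<lambda>u. w0 u * indicator {s<..} u)"
      by (intro Lq_norm_mono[OF p]) (auto simp: indicator_def)
    finally show "Npos p (\<lambda>u. ennreal (R t) * (w1 u * indicator {t<..} u) * indicator {s<..} u) \<le>
       Npos p (\<lambda>u. w0 u * indicator {s<..} u)" .
  qed measurable
  finally show ?thesis .
qed

text \<open>
  For any decomposition $f = f_0 + f_1$, the quasi-triangle inequality splits both terms on the left. The
  diagonal contributions ($f_0$ with weight $b_0$, $f_1$ with weight $b_1$) are restrictions of the
  norms in question; the two off-diagonal ones are converted by the two preceding lemmas.
\<close>

lemma K_interp_lower:
  fixes A0 A1 :: "'a::real_vector qspace" and R :: "real \<Rightarrow> real"
  assumes q: "quasi_normed A0" "quasi_normed A1" and p: "0 < p"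
    and sv: "slowly_varying b0" "slowly_varying b1"
    and R: "mono_on {0<..} R" "\<And>s. 0 < s \<Longrightarrow> 0 < R s"
      "\<And>s. 0 < s \<Longrightarrow> Npos p (\<lambda>u. weight p b0 u * indicator {s<..} u) =
        ennreal (R s) * Npos p (\<lambda>u. weight p b1 u * indicator {s<..} u)"
  obtains E :: real where
    "\<And>t f. 0 < t \<Longrightarrow> f \<in> sum_space A0 A1 \<Longrightarrow>
      Npos p (\<lambda>u. weight p b0 u * K_fun u f A0 A1 * indicator {..<t} u) +
         ennreal (R t) * Npos p (\<lambda>u. weight p b1 u * K_fun u f A0 A1 * indicator {t<..} u) \<le>
      ennreal E * K_fun (R t) f (interp_space 0 p b0 A0 A1) (interp_space 0 p b1 A0 A1)"
proof -
  let ?w0 = "weight p b0" and ?w1 = "weight p b1" and ?K = "\<lambda>f u. K_fun u f A0 A1"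
  let ?X0 = "interp_space 0 p b0 A0 A1" and ?X1 = "interp_space 0 p b1 A0 A1"
  have w [measurable]: "?w0 \<in> borel_measurable half_line" "?w1 \<in> borel_measurable half_line"
    using sv by (simp_all add: weight_measurable)
  obtain C where C: "C \<ge> 1"
    "\<And>t f g. 0 < t \<Longrightarrow> ?K (f + g) t \<le> ennreal C * (?K f t + ?K g t)"
    by (rule K_fun_quasi_triangle[OF q]) (rule that)
  obtain D where D: "D \<ge> 1" "\<And>S g h. g \<in> borel_measurable (lebesgue_on S) \<Longrightarrow> h \<in> borel_measurable (lebesgue_on S) \<Longrightarrow>
       Lq_norm p S (\<lambda>u. g u + h u) \<le> ennreal D * (Lq_norm p S g + Lq_norm p S h)"
    by (rule Lq_norm_quasi_triangle[OF p]) (rule that)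
  have split: "Npos p (\<lambda>u. w u * ?K (f0 + f1) u * indicator A u) \<le> ennreal (C * D) *
      (Npos p (\<lambda>u. w u * ?K f0 u * indicator A u) + Npos p (\<lambda>u. w u * ?K f1 u * indicator A u))"
    if [measurable]: "w \<in> borel_measurable half_line" "A \<in> sets borel"
      and f: "f0 \<in> sum_space A0 A1" "f1 \<in> sum_space A0 A1" "f0 + f1 \<in> sum_space A0 A1" for w A f0 f1
  proof -
    note f[THEN K_fun_measurable[OF q(2)], measurable]
    have "Npos p (\<lambda>u. w u * ?K (f0 + f1) u * indicator A u) \<le>
        Npos p (\<lambda>u. ennreal C * (w u * ?K f0 u * indicator A u + w u * ?K f1 u * indicator A u))"
    proof (rule Lq_norm_mono[OF p])
      show "AE u in half_line. w u * ?K (f0 + f1) u * indicator A u \<le>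
          ennreal C * (w u * ?K f0 u * indicator A u + w u * ?K f1 u * indicator A u)"
      proof (rule AE_I2)
        fix u :: real assume "u \<in> space half_line"
        then have u: "0 < u" by (simp add: space_restrict_space)
        have "(w u * indicator A u) * ?K (f0 + f1) u \<le> (w u * indicator A u) * (ennreal C * (?K f0 u + ?K f1 u))"
          by (intro mult_left_mono C(2) u) simp
        then show "w u * ?K (f0 + f1) u * indicator A u \<le>
          ennreal C * (w u * ?K f0 u * indicator A u + w u * ?K f1 u * indicator A u)"
          by (simp only: distrib_left mult_ac)
      qed
    qed measurable
    also have "\<dots> \<le> ennreal C * Npos p (\<lambda>u. w u * ?K f0 u * indicator A u + w u * ?K f1 u * indicator A u)"
      by (rule Lq_norm_cmult[OF p]) measurable
    also have "\<dots> \<le> ennreal C * (ennreal D *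
      (Npos p (\<lambda>u. w u * ?K f0 u * indicator A u) + Npos p (\<lambda>u. w u * ?K f1 u * indicator A u)))"
      by (intro mult_left_mono D(2)) auto
    finally show ?thesis using C(1) D(1) by (simp add: ennreal_mult mult.assoc)
  qed
  show ?thesis
  proof (rule that)
    fix t :: real and f assume t: "0 < t" and f: "f \<in> sum_space A0 A1"
    let ?IJ = "\<lambda>f. Npos p (\<lambda>u. ?w0 u * ?K f u * indicator {..<t} u) +
         ennreal (R t) * Npos p (\<lambda>u. ?w1 u * ?K f u * indicator {t<..} u)"
    show "?IJ f \<le> ennreal (C * D * 2) * K_fun (R t) f ?X0 ?X1"
      unfolding K_fun_def[of "R t"]
    proof (rule le_mult_Inf)
      show "0 < C * D * 2" using C(1) D(1) by simp
      fix a assume "a \<in> {ennreal (qnorm ?X0 f0 + R t * qnorm ?X1 f1) |f0 f1.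
          f0 \<in> space_of ?X0 \<and> f1 \<in> space_of ?X1 \<and> f = f0 + f1}"
      then obtain f0 f1 where f01: "f0 \<in> space_of ?X0" "f1 \<in> space_of ?X1" "f = f0 + f1"
        and a: "a = ennreal (qnorm ?X0 f0 + R t * qnorm ?X1 f1)" by blast
      let ?N0 = "Npos p (\<lambda>u. ?w0 u * ?K f0 u)" and ?N1 = "Npos p (\<lambda>u. ?w1 u * ?K f1 u)"
      have sums: "f0 \<in> sum_space A0 A1" "f1 \<in> sum_space A0 A1" "f0 + f1 \<in> sum_space A0 A1"
        using f01 f by (simp_all add: interp_space_def)
      have a_eq: "a = ?N0 + ennreal (R t) * ?N1"
        using f01(1,2) R(2)[OF t] unfolding a
        by (simp add: interp_space_def ennreal_mult' interp_norm_eq)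
      note sums[THEN K_fun_measurable[OF q(2)], measurable]
      obtain k0 where k0: "mono_on {0<..} k0" "\<And>u. 0 \<le> k0 u" "?K f0 = (\<lambda>u. ennreal (k0 u))"
        by (rule K_fun_monotone_real[OF q(2) sums(1)]) (rule that)
      obtain k1 where k1: "mono_on {0<..} k1" "\<And>u. 0 \<le> k1 u" "?K f1 = (\<lambda>u. ennreal (k1 u))"
        by (rule K_fun_monotone_real[OF q(2) sums(2)]) (rule that)
      have k_eq: "K_fun u f0 A0 A1 = ennreal (k0 u)" "K_fun u f1 A0 A1 = ennreal (k1 u)" for u
        using fun_cong[OF k0(3)] fun_cong[OF k1(3)] by simp_all
      have "Npos p (\<lambda>u. ?w0 u * ?K f0 u * indicator {..<t} u) \<le> ?N0"
        by (intro Lq_norm_mono[OF p]) (auto simp: indicator_def)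
      moreover have "Npos p (\<lambda>u. ?w0 u * ?K f1 u * indicator {..<t} u) \<le> ennreal (R t) * ?N1"
        using head_le_rho[OF p w R k1(1,2) t] by (simp only: k_eq)
      ultimately have I: "Npos p (\<lambda>u. ?w0 u * ?K f0 u * indicator {..<t} u) +
          Npos p (\<lambda>u. ?w0 u * ?K f1 u * indicator {..<t} u) \<le> a"
        unfolding a_eq by (rule add_mono)
      have "ennreal (R t) * Npos p (\<lambda>u. ?w1 u * ?K f1 u * indicator {t<..} u) \<le> ennreal (R t) * ?N1"
        by (intro mult_left_mono Lq_norm_mono[OF p]) (auto simp: indicator_def)
      moreover have "ennreal (R t) * Npos p (\<lambda>u. ?w1 u * ?K f0 u * indicator {t<..} u) \<le> ?N0"
        using rho_tail_le[OF p w R k0(1,2) t] by (simp only: k_eq)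
      ultimately have J: "ennreal (R t) * (Npos p (\<lambda>u. ?w1 u * ?K f0 u * indicator {t<..} u) +
          Npos p (\<lambda>u. ?w1 u * ?K f1 u * indicator {t<..} u)) \<le> a"
        unfolding a_eq distrib_left by (intro add_mono)
      have "?IJ f \<le> ennreal (C * D) * (Npos p (\<lambda>u. ?w0 u * ?K f0 u * indicator {..<t} u) +
            Npos p (\<lambda>u. ?w0 u * ?K f1 u * indicator {..<t} u)) +
          ennreal (R t) * (ennreal (C * D) * (Npos p (\<lambda>u. ?w1 u * ?K f0 u * indicator {t<..} u) +
            Npos p (\<lambda>u. ?w1 u * ?K f1 u * indicator {t<..} u)))"
        unfolding f01(3) by (intro add_mono mult_left_mono split sums w) auto
      also have "\<dots> = ennreal (C * D) * ((Npos p (\<lambda>u. ?w0 u * ?K f0 u * indicator {..<t} u) +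
            Npos p (\<lambda>u. ?w0 u * ?K f1 u * indicator {..<t} u)) +
          ennreal (R t) * (Npos p (\<lambda>u. ?w1 u * ?K f0 u * indicator {t<..} u) +
            Npos p (\<lambda>u. ?w1 u * ?K f1 u * indicator {t<..} u)))"
        by (simp only: distrib_left mult_ac)
      also have "\<dots> \<le> ennreal (C * D) * (a + a)"
        by (intro mult_left_mono add_mono I J) auto
      also have "\<dots> = ennreal (C * D * 2) * a"
        using C(1) D(1) by (simp add: ennreal_mult mult_2[symmetric] mult_ac)
      finally show "?IJ f \<le> ennreal (C * D * 2) * a" .
    qed
  qed
qed

section \<open>The upper estimate\<close>

text \<open>
  Any decomposition of $f$ in the couple $(A_0, A_1)$ with cost less than $M$ at $t$ is also a good
  decomposition in the couple of interpolation spaces. Below $t$, $K(u, f_0)$ is at most a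
  multiple of $K(u, f) + M u/t$, because $K(u, f_1) \le M u/t$; above $t$ it is at most $M$. For
  $f_1$ the two ranges change roles. The quasi-norms of the error terms are multiples of $M$ times a tail of the
  weight. The bound $M$ is kept as a free parameter rather than set to $2K(t,f)$, so that
  $K(t, f) = 0$ is no special case.
\<close>

lemma weighted_decomposition_upper:
  fixes A0 A1 :: "'a::real_vector qspace" and R :: "real \<Rightarrow> real"
  assumes q: "quasi_normed A0" "quasi_normed A1" and p: "0 < p"
    and b: "b0 \<in> SV0 p" "b1 \<in> SV0 p"
    and R: "\<And>s. 0 < s \<Longrightarrow> 0 < R s"
      "\<And>s. 0 < s \<Longrightarrow> Npos p (\<lambda>u. weight p b0 u * indicator {s<..} u) =
        ennreal (R s) * Npos p (\<lambda>u. weight p b1 u * indicator {s<..} u)"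
  obtains E :: real where "E > 0"
    "\<And>t f M. 0 < t \<Longrightarrow> f \<in> sum_space A0 A1 \<Longrightarrow> K_fun t f A0 A1 < ennreal M \<Longrightarrow>
      K_fun (R t) f (interp_space 0 p b0 A0 A1) (interp_space 0 p b1 A0 A1) \<le>
      ennreal E *
       ((Npos p (\<lambda>u. weight p b0 u * K_fun u f A0 A1 * indicator {..<t} u) +
         ennreal (R t) * Npos p (\<lambda>u. weight p b1 u * K_fun u f A0 A1 * indicator {t<..} u)) +
        ennreal M * Npos p (\<lambda>u. weight p b0 u * indicator {t<..} u))"
proof -
  let ?w0 = "weight p b0" and ?w1 = "weight p b1" and ?K = "\<lambda>f u. K_fun u f A0 A1"
  have sv: "slowly_varying b0" "slowly_varying b1" using b by (simp_all add: SV0_def)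
  note weight_measurable[OF sv(1), measurable] weight_measurable[OF sv(2), measurable]
  obtain C where C: "C \<ge> 1"
    "\<And>t f g. 0 < t \<Longrightarrow> ?K (f + g) t \<le> ennreal C * (?K f t + ?K g t)"
    by (rule K_fun_quasi_triangle[OF q]) (rule that)
  obtain D where D: "D \<ge> 1" "\<And>S g h. g \<in> borel_measurable (lebesgue_on S) \<Longrightarrow> h \<in> borel_measurable (lebesgue_on S) \<Longrightarrow>
       Lq_norm p S (\<lambda>u. g u + h u) \<le> ennreal D * (Lq_norm p S g + Lq_norm p S h)"
    by (rule Lq_norm_quasi_triangle[OF p]) (rule that)
  obtain D' where D': "D' \<ge> 1" "\<And>t h h1 h2. h \<in> borel_measurable half_line \<Longrightarrow> h1 \<in> borel_measurable half_line \<Longrightarrow>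
       h2 \<in> borel_measurable half_line \<Longrightarrow>
       \<forall>u. 0 < u \<and> u < t \<longrightarrow> h u \<le> h1 u \<Longrightarrow> \<forall>u. 0 < u \<and> t < u \<longrightarrow> h u \<le> h2 u \<Longrightarrow>
       Npos p h \<le> ennreal D' * (Npos p (\<lambda>u. h1 u * indicator {..<t} u) + Npos p (\<lambda>u. h2 u * indicator {t<..} u))"
    by (rule Lq_norm_split_at[OF p]) (rule that)
  obtain c0 where c0: "c0 \<ge> 0" "\<And>t. t > 0 \<Longrightarrow>
       Npos p (\<lambda>u. ?w0 u * ennreal (u / t) * indicator {..<t} u) \<le> ennreal c0 * Npos p (\<lambda>u. ?w0 u * indicator {t<..} u)"
    by (rule head_le_tail[OF p sv(1)]) (rule that)
  obtain c1 where c1: "c1 \<ge> 0" "\<And>t. t > 0 \<Longrightarrow>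
       Npos p (\<lambda>u. ?w1 u * ennreal (u / t) * indicator {..<t} u) \<le> ennreal c1 * Npos p (\<lambda>u. ?w1 u * indicator {t<..} u)"
    by (rule head_le_tail[OF p sv(2)]) (rule that)
  define c where "c = max 1 (max c0 c1)"
  have c: "c \<ge> 1" "c0 \<le> c" "c1 \<le> c" by (auto simp: c_def)
  have double: "ennreal (2 * x) = 2 * ennreal x" for x
    by (subst ennreal_mult') simp_all
  have scale: "Npos p (\<lambda>u. (ennreal m * h u) * indicator A u) \<le> ennreal m * Npos p (\<lambda>u. h u * indicator A u)"
    if [measurable]: "h \<in> borel_measurable half_line" "A \<in> sets borel" for m h A
    using Lq_norm_cmult[OF p, of "\<lambda>u. h u * indicator A u" "{0<..}" "ennreal m"] by (simp add: mult.assoc)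
  have affine: "Npos p (\<lambda>u. (ennreal C * (g u + ennreal m * h u)) * indicator A u) \<le>
      ennreal C * (ennreal D * (Npos p (\<lambda>u. g u * indicator A u) + ennreal m * Npos p (\<lambda>u. h u * indicator A u)))"
    if [measurable]: "g \<in> borel_measurable half_line" "h \<in> borel_measurable half_line" "A \<in> sets borel" for m g h A
  proof -
    have "Npos p (\<lambda>u. (ennreal C * (g u + ennreal m * h u)) * indicator A u) \<le>
        ennreal C * Npos p (\<lambda>u. (g u + ennreal m * h u) * indicator A u)"
      by (rule scale) measurable
    also have "\<dots> = ennreal C * Npos p (\<lambda>u. g u * indicator A u + (ennreal m * h u) * indicator A u)"
      by (simp only: distrib_right)
    also have "\<dots> \<le> ennreal C * (ennreal D * (Npos p (\<lambda>u. g u * indicator A u) + Npos p (\<lambda>u. (ennreal m * h u) * indicator A u)))"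
      by (intro mult_left_mono D(2)) auto
    also have "\<dots> \<le> ennreal C * (ennreal D * (Npos p (\<lambda>u. g u * indicator A u) + ennreal m * Npos p (\<lambda>u. h u * indicator A u)))"
      by (intro mult_left_mono add_left_mono scale) auto
    finally show ?thesis .
  qed
  have heads:
    "Npos p (\<lambda>u. ?w0 u * ennreal (u / t) * indicator {..<t} u) \<le> ennreal c * Npos p (\<lambda>u. ?w0 u * indicator {t<..} u)"
    "Npos p (\<lambda>u. ?w1 u * ennreal (u / t) * indicator {..<t} u) \<le> ennreal c * Npos p (\<lambda>u. ?w1 u * indicator {t<..} u)"
    if t: "t > 0" for t
    using order_trans[OF c0(2)[OF t] mult_right_mono[OF ennreal_leI[OF c(2)]]]
      order_trans[OF c1(2)[OF t] mult_right_mono[OF ennreal_leI[OF c(3)]]] by simp_all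
  define E where "E = D' * (C * D * (1 + c) + (1 + c))"
  have E: "E > 0" unfolding E_def using C(1) D(1) D'(1) c(1)
    by (intro mult_pos_pos add_pos_pos) auto
  (* the common shape of the two estimates below: Y is I or J, and Z is M times a tail *)
  have absorb: "X \<le> ennreal E * (Y + Z)"
    if X: "X \<le> ennreal D' * (ennreal C * (ennreal D * (Y + ennreal c * Z)) + ennreal (1 + c) * Z)" for X Y Z
  proof -
    have "Y + ennreal c * Z \<le> ennreal (1 + c) * (Y + Z)"
    proof -
      have "Y + ennreal c * Z \<le> (Y + ennreal c * Z) + (ennreal c * Y + Z)" by simp
      also have "\<dots> = ennreal (1 + c) * (Y + Z)"
        by (simp only: ennreal_plus[OF zero_le_one order_trans[OF zero_le_one c(1)]] ennreal_1)
          (simp only: distrib_left distrib_right mult_1 add_ac)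
      finally show ?thesis .
    qed
    moreover have "Z \<le> Y + Z" by simp
    ultimately have "ennreal D' * (ennreal C * (ennreal D * (Y + ennreal c * Z)) + ennreal (1 + c) * Z) \<le>
       ennreal D' * (ennreal C * (ennreal D * (ennreal (1 + c) * (Y + Z))) + ennreal (1 + c) * (Y + Z))"
      by (intro mult_left_mono add_mono) auto
    also have "\<dots> = (ennreal D' * (ennreal C * ennreal D * ennreal (1 + c) + ennreal (1 + c))) * (Y + Z)"
      by (simp only: distrib_left distrib_right mult_ac)
    also have "ennreal D' * (ennreal C * ennreal D * ennreal (1 + c) + ennreal (1 + c)) = ennreal E"
      unfolding E_def using C(1) D(1) D'(1) c(1)
      by (simp add: ennreal_mult[symmetric] ennreal_plus[symmetric] del: ennreal_plus)
    finally show ?thesis using X by simp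
  qed
  have "K_fun (R t) f (interp_space 0 p b0 A0 A1) (interp_space 0 p b1 A0 A1) \<le>
      ennreal E *
       ((Npos p (\<lambda>u. ?w0 u * ?K f u * indicator {..<t} u) +
         ennreal (R t) * Npos p (\<lambda>u. ?w1 u * ?K f u * indicator {t<..} u)) +
        ennreal (2 * M) * Npos p (\<lambda>u. ?w0 u * indicator {t<..} u))"
    (is "_ \<le> _ * ((?I + ennreal (R t) * ?J) + _ * ?B0)")
    if t: "0 < t" and f: "f \<in> sum_space A0 A1" and M: "?K f t < ennreal M" for t f M
  proof (cases "?I < top \<and> ?J < top")
    case False
    then consider "?I = top" | "?J = top" using less_top by blast
    then have infinite: "?I + ennreal (R t) * ?J = top"
    proof cases
      assume I: "?I = top"
      show ?thesis unfolding I by simp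
    next
      assume J: "?J = top"
      show ?thesis unfolding J using R(1)[OF t] by (simp add: ennreal_mult_top)
    qed
    have "ennreal E * (top + x) = top" for x using E by (simp add: ennreal_mult_top)
    then show ?thesis unfolding infinite by simp
  next
    case True
    let ?B1 = "Npos p (\<lambda>u. ?w1 u * indicator {t<..} u)"
    obtain f0 f1 where f01: "f0 \<in> space_of A0" "f1 \<in> space_of A1" "f = f0 + f1"
      "qnorm A0 f0 + t * qnorm A1 f1 < M"
      using K_fun_less_decomposition[OF M] by blast
    note n0 = quasi_normedD(3)[OF q(1) f01(1)] and n1 = quasi_normedD(3)[OF q(2) f01(2)]
    have f0M: "qnorm A0 f0 \<le> M" and f1M: "t * qnorm A1 f1 \<le> M" and M0: "0 \<le> M"
      using f01(4) n0 mult_nonneg_nonneg[OF less_imp_le[OF t] n1] by linarith+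
    have sums: "f0 \<in> sum_space A0 A1" "f1 \<in> sum_space A0 A1"
    proof -
      have "f0 + 0 \<in> sum_space A0 A1" "0 + f1 \<in> sum_space A0 A1"
        using f01(1,2) quasi_normedD(1)[OF q(1)] quasi_normedD(1)[OF q(2)] unfolding sum_space_def by blast+
      then show "f0 \<in> sum_space A0 A1" "f1 \<in> sum_space A0 A1" by simp_all
    qed
    note K_fun_measurable[OF q(2) sums(1), measurable] K_fun_measurable[OF q(2) sums(2), measurable]
      K_fun_measurable[OF q(2) f, measurable]
    have small0: "?K g u \<le> ennreal M" if "g \<in> space_of A0" "qnorm A0 g \<le> M" for g u
      using order_trans[OF K_fun_le[OF that(1) quasi_normedD(1)[OF q(2)], of u] ennreal_leI[of _ M]]
        that(2) quasi_normedD(2)[OF q(2)] by simp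
    have small1: "?K g u \<le> ennreal M * ennreal (u / t)"
      if g: "g \<in> space_of A1" "t * qnorm A1 g \<le> M" and u: "0 < u" for g u
    proof -
      have "?K g u \<le> ennreal (u * qnorm A1 g)"
        using K_fun_le[OF quasi_normedD(1)[OF q(1)] g(1), of u] quasi_normedD(2)[OF q(1)] by simp
      also have "u * qnorm A1 g = (u / t) * (t * qnorm A1 g)" using t by simp
      also have "ennreal \<dots> \<le> ennreal ((u / t) * M)"
        using g(2) u t by (intro ennreal_leI mult_left_mono) auto
      also have "\<dots> = ennreal M * ennreal (u / t)"
        using M0 u t by (simp add: ennreal_mult[symmetric] mult.commute)
      finally show ?thesis .
    qed
    have K0: "?K f0 u \<le> ennreal C * (?K f u + ennreal M * ennreal (u / t))" if u: "0 < u" for u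
    proof -
      have "?K f0 u \<le> ennreal C * (?K f u + ?K (- f1) u)"
        using C(2)[OF u, of f "- f1"] f01(3) by simp
      also have "\<dots> \<le> ennreal C * (?K f u + ennreal M * ennreal (u / t))"
        using f1M quasi_normedD(5,6)[OF q(2) f01(2)] u by (intro mult_left_mono add_left_mono small1) auto
      finally show ?thesis .
    qed
    have K1: "?K f1 u \<le> ennreal C * (?K f u + ennreal M)" if u: "0 < u" for u
    proof -
      have "?K f1 u \<le> ennreal C * (?K f u + ?K (- f0) u)"
        using C(2)[OF u, of f "- f0"] f01(3) by simp
      also have "\<dots> \<le> ennreal C * (?K f u + ennreal M)"
        using f0M quasi_normedD(5,6)[OF q(1) f01(1)] by (intro mult_left_mono add_left_mono small0) auto
      finally show ?thesis .
    qed
    have X0: "Npos p (\<lambda>u. ?w0 u * ?K f0 u) \<le> ennreal E * (?I + ennreal M * ?B0)"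
    proof (rule absorb)
      have "Npos p (\<lambda>u. ?w0 u * ?K f0 u) \<le> ennreal D' *
          (Npos p (\<lambda>u. (ennreal C * (?w0 u * ?K f u + ennreal M * (?w0 u * ennreal (u / t)))) * indicator {..<t} u) +
           Npos p (\<lambda>u. (ennreal M * ?w0 u) * indicator {t<..} u))"
      proof (rule D'(2); (intro allI impI; elim conjE)?)
        fix u :: real assume u: "0 < u"
        have "?w0 u * ?K f0 u \<le> ?w0 u * (ennreal C * (?K f u + ennreal M * ennreal (u / t)))"
          by (rule mult_left_mono[OF K0[OF u]]) simp
        also have "\<dots> = ennreal C * (?w0 u * ?K f u + ennreal M * (?w0 u * ennreal (u / t)))"
          by (simp only: distrib_left mult_ac)
        finally show "?w0 u * ?K f0 u \<le> ennreal C * (?w0 u * ?K f u + ennreal M * (?w0 u * ennreal (u / t)))" .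
        show "?w0 u * ?K f0 u \<le> ennreal M * ?w0 u"
          using mult_left_mono[OF small0[OF f01(1) f0M], of "?w0 u" u] by (simp add: mult.commute)
      qed measurable
      also have "\<dots> \<le> ennreal D' * (ennreal C * (ennreal D * (?I + ennreal c * (ennreal M * ?B0))) + ennreal (1 + c) * (ennreal M * ?B0))"
      proof (intro mult_left_mono add_mono)
        have "Npos p (\<lambda>u. (ennreal C * (?w0 u * ?K f u + ennreal M * (?w0 u * ennreal (u / t)))) * indicator {..<t} u) \<le>
            ennreal C * (ennreal D * (?I + ennreal M * Npos p (\<lambda>u. ?w0 u * ennreal (u / t) * indicator {..<t} u)))"
          by (rule affine) measurable
        also have "\<dots> \<le> ennreal C * (ennreal D * (?I + ennreal M * (ennreal c * ?B0)))"
          by (intro mult_left_mono add_left_mono heads t) auto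
        finally show "Npos p (\<lambda>u. (ennreal C * (?w0 u * ?K f u + ennreal M * (?w0 u * ennreal (u / t)))) * indicator {..<t} u)
          \<le> ennreal C * (ennreal D * (?I + ennreal c * (ennreal M * ?B0)))"
          by (simp only: mult_ac)
        have "Npos p (\<lambda>u. (ennreal M * ?w0 u) * indicator {t<..} u) \<le> 1 * (ennreal M * ?B0)"
          unfolding mult_1 by (rule scale) measurable
        also have "\<dots> \<le> ennreal (1 + c) * (ennreal M * ?B0)"
          using c(1) ennreal_leI[of 1 "1 + c"] by (intro mult_right_mono) auto
        finally show "Npos p (\<lambda>u. (ennreal M * ?w0 u) * indicator {t<..} u) \<le> ennreal (1 + c) * (ennreal M * ?B0)" .
      qed auto
      finally show "Npos p (\<lambda>u. ?w0 u * ?K f0 u) \<le>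
        ennreal D' * (ennreal C * (ennreal D * (?I + ennreal c * (ennreal M * ?B0))) + ennreal (1 + c) * (ennreal M * ?B0))" .
    qed
    have X1: "Npos p (\<lambda>u. ?w1 u * ?K f1 u) \<le> ennreal E * (?J + ennreal M * ?B1)"
    proof (rule absorb)
      have "Npos p (\<lambda>u. ?w1 u * ?K f1 u) \<le> ennreal D' *
          (Npos p (\<lambda>u. (ennreal M * (?w1 u * ennreal (u / t))) * indicator {..<t} u) +
           Npos p (\<lambda>u. (ennreal C * (?w1 u * ?K f u + ennreal M * ?w1 u)) * indicator {t<..} u))"
      proof (rule D'(2); (intro allI impI; elim conjE)?)
        fix u :: real assume u: "0 < u"
        have "?w1 u * ?K f1 u \<le> ?w1 u * (ennreal C * (?K f u + ennreal M))"
          by (rule mult_left_mono[OF K1[OF u]]) simp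
        also have "\<dots> = ennreal C * (?w1 u * ?K f u + ennreal M * ?w1 u)"
          by (simp only: distrib_left mult_ac)
        finally show "?w1 u * ?K f1 u \<le> ennreal C * (?w1 u * ?K f u + ennreal M * ?w1 u)" .
        show "?w1 u * ?K f1 u \<le> ennreal M * (?w1 u * ennreal (u / t))"
          using mult_left_mono[OF small1[OF f01(2) f1M u], of "?w1 u"] by (simp add: mult_ac)
      qed measurable
      also have "\<dots> \<le> ennreal D' * (ennreal (1 + c) * (ennreal M * ?B1) + ennreal C * (ennreal D * (?J + ennreal c * (ennreal M * ?B1))))"
      proof (intro mult_left_mono add_mono)
        have "Npos p (\<lambda>u. (ennreal M * (?w1 u * ennreal (u / t))) * indicator {..<t} u) \<le>
            ennreal M * Npos p (\<lambda>u. ?w1 u * ennreal (u / t) * indicator {..<t} u)"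
          by (rule scale) measurable
        also have "\<dots> \<le> ennreal M * (ennreal c * ?B1)"
          by (intro mult_left_mono heads t) auto
        also have "\<dots> = ennreal c * (ennreal M * ?B1)" by (simp only: mult_ac)
        also have "\<dots> \<le> ennreal (1 + c) * (ennreal M * ?B1)"
          by (intro mult_right_mono ennreal_leI) auto
        finally show "Npos p (\<lambda>u. (ennreal M * (?w1 u * ennreal (u / t))) * indicator {..<t} u) \<le> ennreal (1 + c) * (ennreal M * ?B1)" .
        have "Npos p (\<lambda>u. (ennreal C * (?w1 u * ?K f u + ennreal M * ?w1 u)) * indicator {t<..} u) \<le>
            ennreal C * (ennreal D * (?J + 1 * (ennreal M * ?B1)))"
          unfolding mult_1 by (rule affine) measurable
        also have "\<dots> \<le> ennreal C * (ennreal D * (?J + ennreal c * (ennreal M * ?B1)))"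
          using c(1) ennreal_leI[of 1 c] by (intro mult_left_mono add_left_mono mult_right_mono) auto
        finally show "Npos p (\<lambda>u. (ennreal C * (?w1 u * ?K f u + ennreal M * ?w1 u)) * indicator {t<..} u) \<le>
            ennreal C * (ennreal D * (?J + ennreal c * (ennreal M * ?B1)))" .
      qed auto
      finally show "Npos p (\<lambda>u. ?w1 u * ?K f1 u) \<le>
        ennreal D' * (ennreal C * (ennreal D * (?J + ennreal c * (ennreal M * ?B1))) + ennreal (1 + c) * (ennreal M * ?B1))"
        by (simp only: add.commute)
    qed
    have fin: "?B0 < top" "?B1 < top"
      using tail_finite[OF p b(1) t] tail_finite[OF p b(2) t] by simp_all
    let ?X0 = "interp_space 0 p b0 A0 A1" and ?X1 = "interp_space 0 p b1 A0 A1"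
    have N0: "interp_norm 0 p b0 A0 A1 f0 < top" and N1: "interp_norm 0 p b1 A0 A1 f1 < top"
    proof -
      have "ennreal E * (?I + ennreal M * ?B0) < top" "ennreal E * (?J + ennreal M * ?B1) < top"
        using True fin by (simp_all add: ennreal_mult_less_top)
      then show "interp_norm 0 p b0 A0 A1 f0 < top" "interp_norm 0 p b1 A0 A1 f1 < top"
        unfolding interp_norm_eq using le_less_trans[OF X0] le_less_trans[OF X1] by blast+
    qed
    then have "f0 \<in> space_of ?X0" "f1 \<in> space_of ?X1"
      using sums by (simp_all add: interp_space_def)
    then have "K_fun (R t) f ?X0 ?X1 \<le> ennreal (qnorm ?X0 f0 + R t * qnorm ?X1 f1)"
      unfolding f01(3) by (rule K_fun_le)
    also have "\<dots> = interp_norm 0 p b0 A0 A1 f0 + ennreal (R t) * interp_norm 0 p b1 A0 A1 f1"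
      using N0 N1 R(1)[OF t] by (simp add: interp_space_def ennreal_mult')
    also have "\<dots> \<le> ennreal E * (?I + ennreal M * ?B0) + ennreal (R t) * (ennreal E * (?J + ennreal M * ?B1))"
      unfolding interp_norm_eq by (intro add_mono mult_left_mono X0 X1) auto
    also have "\<dots> = ennreal E * ((?I + ennreal (R t) * ?J) + (ennreal M * ?B0 + ennreal M * (ennreal (R t) * ?B1)))"
      by (simp only: distrib_left add_ac mult_ac)
    also have "ennreal M * ?B0 + ennreal M * (ennreal (R t) * ?B1) = ennreal (2 * M) * ?B0"
      unfolding R(2)[OF t, symmetric] double by (simp only: mult_2 distrib_right)
    finally show ?thesis .
  qed
  note bound = this
  show ?thesis
  proof (rule that[of "2 * E"])
    fix t :: real and f M assume *: "0 < t" "f \<in> sum_space A0 A1" "K_fun t f A0 A1 < ennreal M"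
    let ?IJ = "Npos p (\<lambda>u. ?w0 u * ?K f u * indicator {..<t} u) +
         ennreal (R t) * Npos p (\<lambda>u. ?w1 u * ?K f u * indicator {t<..} u)"
    let ?B0 = "Npos p (\<lambda>u. ?w0 u * indicator {t<..} u)"
    have "K_fun (R t) f (interp_space 0 p b0 A0 A1) (interp_space 0 p b1 A0 A1) \<le>
        ennreal E * (?IJ + ennreal (2 * M) * ?B0)" by (rule bound[OF *])
    also have "\<dots> \<le> ennreal E * (2 * ?IJ + ennreal (2 * M) * ?B0)"
      by (intro mult_left_mono add_right_mono) (auto simp: mult_2)
    also have "\<dots> = ennreal (2 * E) * (?IJ + ennreal M * ?B0)"
      unfolding double by (simp only: distrib_left mult_ac)
    finally show "K_fun (R t) f (interp_space 0 p b0 A0 A1) (interp_space 0 p b1 A0 A1) \<le>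
        ennreal (2 * E) * (?IJ + ennreal M * ?B0)" .
  qed (use E in simp)
qed

text \<open>
  Let $M$ tend to $K(t, f)$ in the preceding lemma. The extra term is then absorbed:
  $\|w_0\|_{(t,\infty)} K(t,f) = R(t) \|w_1\|_{(t,\infty)} K(t,f)$, and $K(t,f) \le K(u,f)$ for
  $u > t$.
\<close>

lemma K_interp_upper:
  fixes A0 A1 :: "'a::real_vector qspace" and R :: "real \<Rightarrow> real"
  assumes q: "quasi_normed A0" "quasi_normed A1" and p: "0 < p"
    and b: "b0 \<in> SV0 p" "b1 \<in> SV0 p"
    and R: "\<And>s. 0 < s \<Longrightarrow> 0 < R s"
      "\<And>s. 0 < s \<Longrightarrow> Npos p (\<lambda>u. weight p b0 u * indicator {s<..} u) =
        ennreal (R s) * Npos p (\<lambda>u. weight p b1 u * indicator {s<..} u)"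
  obtains E :: real where
    "\<And>t f. 0 < t \<Longrightarrow> f \<in> sum_space A0 A1 \<Longrightarrow>
      K_fun (R t) f (interp_space 0 p b0 A0 A1) (interp_space 0 p b1 A0 A1) \<le>
      ennreal E * (Npos p (\<lambda>u. weight p b0 u * K_fun u f A0 A1 * indicator {..<t} u) +
         ennreal (R t) * Npos p (\<lambda>u. weight p b1 u * K_fun u f A0 A1 * indicator {t<..} u))"
proof -
  let ?w0 = "weight p b0" and ?w1 = "weight p b1" and ?K = "\<lambda>f u. K_fun u f A0 A1"
  have sv: "slowly_varying b0" "slowly_varying b1" using b by (simp_all add: SV0_def)
  note weight_measurable[OF sv(1), measurable] weight_measurable[OF sv(2), measurable]
  obtain E :: real where E: "E > 0" "\<And>t f M. 0 < t \<Longrightarrow> f \<in> sum_space A0 A1 \<Longrightarrow> ?K f t < ennreal M \<Longrightarrow>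
      K_fun (R t) f (interp_space 0 p b0 A0 A1) (interp_space 0 p b1 A0 A1) \<le>
      ennreal E * ((Npos p (\<lambda>u. ?w0 u * ?K f u * indicator {..<t} u) +
         ennreal (R t) * Npos p (\<lambda>u. ?w1 u * ?K f u * indicator {t<..} u)) +
        ennreal M * Npos p (\<lambda>u. ?w0 u * indicator {t<..} u))"
    by (rule weighted_decomposition_upper[OF q p b R]) (assumption | rule that)+
  show ?thesis
  proof (rule that)
    fix t :: real and f assume t: "0 < t" and f: "f \<in> sum_space A0 A1"
    let ?I = "Npos p (\<lambda>u. ?w0 u * ?K f u * indicator {..<t} u)"
    let ?J = "Npos p (\<lambda>u. ?w1 u * ?K f u * indicator {t<..} u)"
    let ?B0 = "Npos p (\<lambda>u. ?w0 u * indicator {t<..} u)"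
    let ?B1 = "Npos p (\<lambda>u. ?w1 u * indicator {t<..} u)"
    let ?L = "K_fun (R t) f (interp_space 0 p b0 A0 A1) (interp_space 0 p b1 A0 A1)"
    note K_fun_measurable[OF q(2) f, measurable]
    obtain k where k: "?K f t = ennreal k" "0 \<le> k"
      using K_fun_finite[OF f, of t] by (cases "?K f t") auto
    obtain \<beta> where \<beta>: "?B0 = ennreal \<beta>" "0 \<le> \<beta>"
      using tail_finite[OF p b(1) t] by (cases ?B0) auto
    have "?L \<le> ennreal E * ((?I + ennreal (R t) * ?J) + ennreal k * ?B0)"
    proof (rule ennreal_le_epsilon)
      fix e :: real assume e: "0 < e"
      (* \<beta> + 1 instead of \<beta> keeps the denominator positive *)
      define d where "d = e / (E * (\<beta> + 1))"
      have "0 < d" using e E(1) \<beta>(2) by (auto simp: d_def intro!: divide_pos_pos mult_pos_pos)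
      moreover have "E * (d * \<beta>) = e * \<beta> / (\<beta> + 1)" using E(1) by (simp add: d_def)
      moreover have "e * \<beta> / (\<beta> + 1) \<le> e" using e \<beta>(2) by (simp add: pos_divide_le_eq distrib_left)
      ultimately have d: "0 < d" "E * (d * \<beta>) \<le> e" by simp_all
      have "?L \<le> ennreal E * ((?I + ennreal (R t) * ?J) + ennreal (k + d) * ?B0)"
        using k d by (intro E(2) t f) (simp add: ennreal_less_iff)
      also have "\<dots> = ennreal E * ((?I + ennreal (R t) * ?J) + ennreal k * ?B0) + ennreal (E * (d * \<beta>))"
        using k d E(1) \<beta> by (simp add: distrib_left distrib_right ennreal_mult add.assoc)
      also have "\<dots> \<le> ennreal E * ((?I + ennreal (R t) * ?J) + ennreal k * ?B0) + ennreal e"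
        using d(2) by (intro add_left_mono ennreal_leI)
      finally show "?L \<le> ennreal E * ((?I + ennreal (R t) * ?J) + ennreal k * ?B0) + ennreal e" .
    qed
    also have "\<dots> \<le> ennreal E * ((?I + ennreal (R t) * ?J) + ennreal (R t) * ?J)"
    proof (intro mult_left_mono add_left_mono)
      have "ennreal k * ?B1 \<le> ?J"
      proof (cases "k = 0")
        case False
        then have "ennreal k * ?B1 = Npos p (\<lambda>u. ennreal k * (?w1 u * indicator {t<..} u))"
          using k(2) by (intro Lq_norm_cmult_eq[symmetric, OF p]) auto
        also have "\<dots> \<le> ?J"
        proof (rule Lq_norm_mono[OF p])
          show "AE u in half_line. ennreal k * (?w1 u * indicator {t<..} u) \<le> ?w1 u * ?K f u * indicator {t<..} u"
          proof (rule AE_I2)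
            fix u
            show "ennreal k * (?w1 u * indicator {t<..} u) \<le> ?w1 u * ?K f u * indicator {t<..} u"
              using mult_left_mono[OF K_fun_mono[OF q(2), of t u f A0], of "?w1 u"] k(1)
              by (auto simp: indicator_def mult.commute)
          qed
        qed measurable
        finally show ?thesis .
      qed simp
      then have "ennreal (R t) * (ennreal k * ?B1) \<le> ennreal (R t) * ?J" by (rule mult_left_mono) simp
      then show "ennreal k * ?B0 \<le> ennreal (R t) * ?J" unfolding R(2)[OF t] by (simp only: mult_ac)
    qed simp
    also have "ennreal E * ((?I + ennreal (R t) * ?J) + ennreal (R t) * ?J) \<le>
        ennreal E * ((?I + ennreal (R t) * ?J) + (?I + ennreal (R t) * ?J))"
      by (intro mult_left_mono add_left_mono) auto
    also have "\<dots> = ennreal (2 * E) * (?I + ennreal (R t) * ?J)"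
      using E(1) by (simp add: ennreal_mult' mult_2[symmetric] mult_ac)
    finally show "?L \<le> ennreal (2 * E) * (?I + ennreal (R t) * ?J)" .
  qed
qed

section \<open>The Holmstedt formula\<close>

theorem theorem3p5:
  fixes A0 A1 :: "'a::real_vector qspace"
    and p :: ennreal
    and b0 b1 \<rho> :: "real \<Rightarrow> real"
    and I J :: "real \<Rightarrow> 'a \<Rightarrow> ennreal"
  assumes "compatible_couple A0 A1"
    and "0 < p"
    and "b0 \<in> SV0 p" and "b1 \<in> SV0 p"
    and rho_def: "\<rho> = (\<lambda>t.
          enn2real (Lq_norm p {t<..} (\<lambda>u. ennreal (u powr (- recip p) * b0 u))) /
          enn2real (Lq_norm p {t<..} (\<lambda>u. ennreal (u powr (- recip p) * b1 u))))"
    and I_def: "I = (\<lambda>t f.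
          Lq_norm p {0<..<t} (\<lambda>u. ennreal (u powr (- recip p) * b0 u) * K_fun u f A0 A1))"
    and J_def: "J = (\<lambda>t f.
          Lq_norm p {t<..} (\<lambda>u. ennreal (u powr (- recip p) * b1 u) * K_fun u f A0 A1))"
    and "mono_on {0<..} \<rho>"
    and "p < \<infinity> \<Longrightarrow> K_surjective A0 A1"
  shows "approx_on ({0<..} \<times> sum_space A0 A1)
           (\<lambda>(t, f). K_fun (\<rho> t) f (interp_space 0 p b0 A0 A1) (interp_space 0 p b1 A0 A1))
           (\<lambda>(t, f). I t f + ennreal (\<rho> t) * J t f)"
proof -
  note p = \<open>0 < p\<close> and b = \<open>b0 \<in> SV0 p\<close> \<open>b1 \<in> SV0 p\<close>
  have q: "quasi_normed A0" "quasi_normed A1"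
    using assms(1) by (simp_all add: compatible_couple_def)
  have sv: "slowly_varying b0" "slowly_varying b1" using b by (simp_all add: SV0_def)
  let ?w0 = "weight p b0" and ?w1 = "weight p b1" and ?K = "\<lambda>f u. K_fun u f A0 A1"
  note weight_measurable[OF sv(1), measurable] weight_measurable[OF sv(2), measurable]
  have restrict: "Lq_norm p {t<..} g = Npos p (\<lambda>u. g u * indicator {t<..} u)"
    "Lq_norm p {0<..<t} g = Npos p (\<lambda>u. g u * indicator {..<t} u)"
    if t: "0 < t" and [measurable]: "g \<in> borel_measurable half_line" for t g
  proof -
    show "Lq_norm p {t<..} g = Npos p (\<lambda>u. g u * indicator {t<..} u)"
      using t that(2) by (intro Lq_norm_subset[OF p]) auto
    have "Lq_norm p {0<..<t} g = Npos p (\<lambda>u. g u * indicator {0<..<t} u)"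
      using t that(2) by (intro Lq_norm_subset[OF p]) auto
    also have "\<dots> = Npos p (\<lambda>u. g u * indicator {..<t} u)"
      by (intro antisym Lq_norm_mono[OF p] AE_I2) (auto simp: space_restrict_space indicator_def)
    finally show "Lq_norm p {0<..<t} g = Npos p (\<lambda>u. g u * indicator {..<t} u)" .
  qed
  have R: "0 < \<rho> s" "Npos p (\<lambda>u. ?w0 u * indicator {s<..} u) =
      ennreal (\<rho> s) * Npos p (\<lambda>u. ?w1 u * indicator {s<..} u)" if s: "0 < s" for s
  proof -
    let ?B0 = "Npos p (\<lambda>u. ?w0 u * indicator {s<..} u)" and ?B1 = "Npos p (\<lambda>u. ?w1 u * indicator {s<..} u)"
    have \<rho>: "\<rho> s = enn2real ?B0 / enn2real ?B1"
      unfolding rho_def using s by (simp add: restrict)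
    have B: "0 < ?B0" "?B0 < top" "0 < ?B1" "?B1 < top"
      using tail_positive[OF p sv(1) s] tail_positive[OF p sv(2) s]
        tail_finite[OF p b(1) s] tail_finite[OF p b(2) s] by simp_all
    then have pos: "0 < enn2real ?B0" "0 < enn2real ?B1" by (simp_all add: enn2real_positive_iff)
    then show "0 < \<rho> s" by (simp add: \<rho>)
    have "ennreal (\<rho> s) * ennreal (enn2real ?B1) = ennreal (enn2real ?B0)"
      using pos unfolding \<rho> by (subst ennreal_mult[symmetric]) auto
    then show "?B0 = ennreal (\<rho> s) * ?B1" using B by simp
  qed
  have IJ: "I t f + ennreal (\<rho> t) * J t f =
      Npos p (\<lambda>u. ?w0 u * ?K f u * indicator {..<t} u) +
      ennreal (\<rho> t) * Npos p (\<lambda>u. ?w1 u * ?K f u * indicator {t<..} u)"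
    if t: "0 < t" and f: "f \<in> sum_space A0 A1" for t f
  proof -
    note K_fun_measurable[OF q(2) f, measurable]
    show ?thesis unfolding I_def J_def using t by (simp add: restrict)
  qed
  let ?L = "\<lambda>t f. K_fun (\<rho> t) f (interp_space 0 p b0 A0 A1) (interp_space 0 p b1 A0 A1)"
  let ?IJ = "\<lambda>t f. Npos p (\<lambda>u. ?w0 u * ?K f u * indicator {..<t} u) +
      ennreal (\<rho> t) * Npos p (\<lambda>u. ?w1 u * ?K f u * indicator {t<..} u)"
  obtain E where E: "\<And>t f. 0 < t \<Longrightarrow> f \<in> sum_space A0 A1 \<Longrightarrow> ?L t f \<le> ennreal E * ?IJ t f"
    by (rule K_interp_upper[OF q p b R]) (assumption | rule that)+
  obtain E' where E': "\<And>t f. 0 < t \<Longrightarrow> f \<in> sum_space A0 A1 \<Longrightarrow> ?IJ t f \<le> ennreal E' * ?L t f"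
    by (rule K_interp_lower[OF q p sv \<open>mono_on {0<..} \<rho>\<close> R]) (assumption | rule that)+
  show ?thesis
    unfolding approx_on_def
  proof
    show "lesssim_on ({0<..} \<times> sum_space A0 A1) (\<lambda>(t, f). ?L t f) (\<lambda>(t, f). I t f + ennreal (\<rho> t) * J t f)"
      by (rule lesssim_onI[where c = E]) (clarsimp simp: IJ E)
    show "lesssim_on ({0<..} \<times> sum_space A0 A1) (\<lambda>(t, f). I t f + ennreal (\<rho> t) * J t f) (\<lambda>(t, f). ?L t f)"
      by (rule lesssim_onI[where c = E']) (clarsimp simp: IJ E')
  qed
qed

end
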